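(* Let $X$ be an $L$-dimensional zero-mean Gaussian random vector with covariance $\Sigma_X=\Theta^T\Lambda_X\Theta\succ0$, where $\Theta$ is unitary and $\Lambda_X=\mathrm{diag}(\lambda_1,\ldots,\lambda_L)$ with $\lambda_\ell>0$. With the squared Wasserstein-2 distance $W_2^2(P_X,P_{\hat X})$ as the perception metric, the rate-distortion-perception function $R(D,P)$ is given by $$R(D,P)=\min_{\{\hat\lambda_\ell,\gamma_\ell\}_{\ell=1}^L}\ \frac12\sum_{\ell=1}^L\log\frac{\lambda_\ell}{\gamma_\ell}$$ subject to $0<\gamma_\ell\le\lambda_\ell$ and $0\le\hat\lambda_\ell$ for all $\ell$, $\sum_{\ell=1}^L\big(\lambda_\ell-2\sqrt{\hat\lambda_\ell(\lambda_\ell-\gamma_\ell)}+\hat\lambda_\ell\big)\le D$, and $\sum_{\ell=1}^L\big(\sqrt{\lambda_\ell}-\sqrt{\hat\lambda_\ell}\big)^2\le P$.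
   Context: The (information) rate-distortion-perception function is $R(D,P)=\inf I(X;\hat X)$ over conditional distributions $P_{\hat X|X}$, $\hat X\in\mathbb{R}^L$, such that $\mathbb{E}[\|X-\hat X\|^2]\le D$ and $W_2^2(P_X,P_{\hat X})\le P$, where $W_2^2(P_X,P_{\hat X})=\inf\mathbb{E}[\|U-V\|^2]$ over couplings with marginals $P_X$ and $P_{\hat X}$. Logarithms are natural. *)

theory Defs
  imports "HOL-Probability.Probability"
begin

definition diag_mat :: "real^'n \<Rightarrow> real^'n^'n" where
  "diag_mat v = (\<chi> i j. if i = j then v $ i else 0)"

definition gaussian_measure :: "real^'n^'n \<Rightarrow> (real^'n) measure" where
  "gaussian_measure S = density lborel (\<lambda>x. ennreal
     ((2 * pi) powr (- real CARD('n) / 2) / sqrt (det S)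
       * exp (- (x \<bullet> (matrix_inv S *v x)) / 2)))"

text \<open>Mutual information I(X;Xh) (natural log) of a joint law J on R^L x R^L,
  as the KL divergence of J from the product of its marginals; +infinity if J is
  not absolutely continuous w.r.t. that product.  The integrand
  f ln f - f + 1 is nonnegative, and its integral equals \<integral> f ln f since both are
  probability measures.\<close>
definition mutual_info :: "('a::euclidean_space \<times> 'a) measure \<Rightarrow> ennreal" where
  "mutual_info J =
     (let Q = distr J borel fst \<Otimes>\<^sub>M distr J borel snd;
          f = (\<lambda>z. enn2real (RN_deriv Q J z))
      in if absolutely_continuous Q J
         then \<integral>\<^sup>+ z. ennreal (f z * ln (f z) - f z + 1) \<partial>Q
         else \<infinity>)"

definition couplings :: "'a::euclidean_space measure \<Rightarrow> 'a measure \<Rightarrow> ('a \<times> 'a) measure set" where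
  "couplings \<mu> \<nu> = {\<pi>. prob_space \<pi> \<and> sets \<pi> = sets (borel \<Otimes>\<^sub>M borel)
       \<and> distr \<pi> borel fst = \<mu> \<and> distr \<pi> borel snd = \<nu>}"

definition W2sq :: "'a::euclidean_space measure \<Rightarrow> 'a measure \<Rightarrow> ennreal" where
  "W2sq \<mu> \<nu> = (INF \<pi> \<in> couplings \<mu> \<nu>. \<integral>\<^sup>+ z. ennreal ((norm (fst z - snd z))\<^sup>2) \<partial>\<pi>)"

text \<open>Information rate-distortion-perception function of a source law PX:
  infimum of I(X;Xh) over joint laws of (X,Xh) whose first marginal is PX
  (equivalently, over conditional laws P_{Xh|X}), subject to
  E||X-Xh||^2 \<le> D and W2^2(PX, P_Xh) \<le> P.\<close>
definition RDP :: "'a::euclidean_space measure \<Rightarrow> real \<Rightarrow> real \<Rightarrow> ennreal" where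
  "RDP PX D P = (INF J \<in> {J. prob_space J \<and> sets J = sets (borel \<Otimes>\<^sub>M borel)
       \<and> distr J borel fst = PX
       \<and> enn2ereal (\<integral>\<^sup>+ z. ennreal ((norm (fst z - snd z))\<^sup>2) \<partial>J) \<le> ereal D
       \<and> enn2ereal (W2sq PX (distr J borel snd)) \<le> ereal P}. mutual_info J)"

definition feasible :: "real^'n \<Rightarrow> real \<Rightarrow> real \<Rightarrow> ((real^'n) \<times> (real^'n)) set" where
  "feasible lam D P = {(lh, g).
     (\<forall>i. 0 < g $ i \<and> g $ i \<le> lam $ i \<and> 0 \<le> lh $ i)
     \<and> (\<Sum>i\<in>UNIV. lam $ i - 2 * sqrt (lh $ i * (lam $ i - g $ i)) + lh $ i) \<le> D
     \<and> (\<Sum>i\<in>UNIV. (sqrt (lam $ i) - sqrt (lh $ i))\<^sup>2) \<le> P}"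

definition objective :: "real^'n \<Rightarrow> (real^'n) \<times> (real^'n) \<Rightarrow> real" where
  "objective lam z = (1/2) * (\<Sum>i\<in>UNIV. ln (lam $ i / snd z $ i))"

end

theory Submission
  imports Defs
begin

text \<open>
  In the coordinates \<open>y = \<Theta> x\<close> the source has independent components \<open>N(0, \<lambda>\<^sub>i)\<close>, and both the distortion
  and the transport cost split into sums over coordinates.

  Converse: for a joint law with second moments \<open>lh\<^sub>i = E yh\<^sub>i\<^sup>2\<close> and linear estimation errors
  \<open>\<gamma>\<^sub>i = E (y\<^sub>i - a\<^sub>i yh\<^sub>i)\<^sup>2\<close>, the Fenchel inequality \<open>u ln u - u \<ge> u ln w - w\<close>, with \<open>w\<close> the likelihood ratio
  \<open>\<Prod> N(y\<^sub>i; a\<^sub>i yh\<^sub>i, \<gamma>\<^sub>i) / N(y\<^sub>i; 0, \<lambda>\<^sub>i)\<close>, bounds the mutual information below by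
  \<open>\<Sum> ln (\<lambda>\<^sub>i / \<gamma>\<^sub>i) / 2\<close>; no chain rule or conditional entropy is needed. Cauchy-Schwarz in each
  coordinate turns the distortion and perception constraints into those of the finite-dimensional program.

  Achievability: the same likelihood ratio, taken as a density with respect to the product of the
  source law and the law of a coordinatewise scaled copy of the source, has the right marginals, and
  its log-likelihood integrates to the objective.
\<close>

section \<open>Rotation invariance and Gaussian integrals\<close>

lemma borel_measurable_mult_vec [measurable]:
  fixes A :: "real^'n^'m"
  shows "(\<lambda>x. A *v x) \<in> borel_measurable borel"
  by (intro borel_measurable_continuous_onI matrix_vector_mult_linear_continuous_on)

text \<open>Both measures are translation invariant, hence proportional by a Fubini argument, and they agree on the unit ball.\<close>
lemma lborel_distr_orthogonal_matrix:
  fixes A :: "real^'n^'n"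
  assumes "orthogonal_matrix A"
  shows "distr lborel borel (\<lambda>x. A *v x) = lborel"
proof (rule measure_eqI)
  fix B :: "(real^'n) set" assume "B \<in> sets (distr lborel borel (\<lambda>x. A *v x))"
  then have B[measurable]: "B \<in> sets borel" by simp
  have AT: "A ** transpose A = mat 1"
    using assms by (auto simp: orthogonal_matrix_def)
  have normA: "norm (A *v x) = norm x" for x
    using assms orthogonal_transformation_norm[of "(*v) A" x] by (simp add: orthogonal_transformation_matrix)
  let ?L = "lborel :: (real^'n) measure"
  let ?E = "ball (0::real^'n) 1"
  have [measurable]: "?E \<in> sets borel" by simp
  have [simp]: "(indicator (ball c 1) :: _ \<Rightarrow> ennreal) \<in> borel_measurable borel" for c :: "real^'n"
    by (rule borel_measurable_indicator) simp
  have shift: "(\<integral>\<^sup>+x. f (c + x) \<partial>?L) = (\<integral>\<^sup>+x. f x \<partial>?L)"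
    if [measurable]: "f \<in> borel_measurable borel" for f c
    by (subst (2) lborel_distr_plus[of c, symmetric], subst nn_integral_distr) auto
  \<comment> \<open>The ball is invariant under \<open>A\<close>. Translating \<open>y\<close> by
    \<open>A *v x\<close> and then \<open>x\<close> by \<open>- (transpose A *v y)\<close> moves the
    dependence on \<open>y\<close> into the ball, so the inner integral is the volume of a ball
    centred at \<open>A *v x\<close>, and what remains is the pushforward measure of
    \<open>B\<close>.\<close>
  have "emeasure ?L ?E * emeasure ?L B = (\<integral>\<^sup>+x. \<integral>\<^sup>+y. indicator ?E (A *v x) * indicator B y \<partial>?L \<partial>?L)"
  proof -
    have "indicator ?E (A *v x) = (indicator ?E x :: ennreal)" for x
      by (simp add: indicator_def normA)
    then show ?thesis
      by (simp add: nn_integral_cmult) (subst nn_integral_multc; simp)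
  qed
  also have "\<dots> = (\<integral>\<^sup>+x. \<integral>\<^sup>+y. indicator ?E (A *v x) * indicator B (A *v x + y) \<partial>?L \<partial>?L)"
  proof (rule nn_integral_cong)
    fix x :: "real^'n"
    show "(\<integral>\<^sup>+y. indicator ?E (A *v x) * indicator B y \<partial>?L)
      = (\<integral>\<^sup>+y. indicator ?E (A *v x) * indicator B (A *v x + y) \<partial>?L)"
      using shift[of "\<lambda>y. indicator ?E (A *v x) * indicator B y" "A *v x"] by simp
  qed
  also have "\<dots> = (\<integral>\<^sup>+y. \<integral>\<^sup>+x. indicator ?E (A *v x) * indicator B (A *v x + y) \<partial>?L \<partial>?L)"
    by (rule lborel_pair.Fubini'[symmetric]) measurable
  also have "\<dots> = (\<integral>\<^sup>+y. \<integral>\<^sup>+x. indicator ?E (A *v x - y) * indicator B (A *v x) \<partial>?L \<partial>?L)"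
  proof (rule nn_integral_cong)
    fix y :: "real^'n"
    have "A *v (- (transpose A *v y) + x) = A *v x - y" for x
      using matrix_vector_mult_diff_distrib[of A x "transpose A *v y"]
      by (simp add: matrix_vector_mul_assoc AT del: transpose_matrix_vector)
    then show "(\<integral>\<^sup>+x. indicator ?E (A *v x) * indicator B (A *v x + y) \<partial>?L)
      = (\<integral>\<^sup>+x. indicator ?E (A *v x - y) * indicator B (A *v x) \<partial>?L)"
      using shift[of "\<lambda>x. indicator ?E (A *v x) * indicator B (A *v x + y)" "- (transpose A *v y)"]
      by (simp del: transpose_matrix_vector)
  qed
  also have "\<dots> = (\<integral>\<^sup>+x. \<integral>\<^sup>+y. indicator ?E (A *v x - y) * indicator B (A *v x) \<partial>?L \<partial>?L)"
    by (rule lborel_pair.Fubini') measurable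
  also have "\<dots> = (\<integral>\<^sup>+x. emeasure ?L ?E * indicator B (A *v x) \<partial>?L)"
  proof (rule nn_integral_cong)
    fix x :: "real^'n"
    have "indicator ?E (A *v x - y) = (indicator (ball (A *v x) 1) y :: ennreal)" for y
      by (simp add: indicator_def dist_norm norm_minus_commute)
    then show "(\<integral>\<^sup>+y. indicator ?E (A *v x - y) * indicator B (A *v x) \<partial>?L) = emeasure ?L ?E * indicator B (A *v x)"
      by simp (subst nn_integral_multc; simp add: emeasure_ball)
  qed
  also have "\<dots> = emeasure ?L ?E * emeasure (distr ?L borel (\<lambda>x. A *v x)) B"
  proof -
    have "(\<integral>\<^sup>+x. indicator B (A *v x) \<partial>?L) = emeasure (distr ?L borel (\<lambda>x. A *v x)) B"
      by (subst nn_integral_indicator[symmetric], simp, subst nn_integral_distr) auto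
    then show ?thesis by (simp add: nn_integral_cmult)
  qed
  finally have "emeasure ?L ?E * emeasure ?L B = emeasure ?L ?E * emeasure (distr ?L borel (\<lambda>x. A *v x)) B" .
  moreover have "emeasure ?L ?E \<noteq> 0" "emeasure ?L ?E \<noteq> \<top>"
    using unit_ball_vol_pos[of "real CARD('n)"] by (auto simp: emeasure_ball simp del: unit_ball_vol_pos)
  ultimately show "emeasure (distr ?L borel (\<lambda>x. A *v x)) B = emeasure ?L B"
    by (simp add: ennreal_mult_cancel_left)
qed simp

lemma nn_integral_lborel_prod_cart:
  fixes f :: "'n::finite \<Rightarrow> real \<Rightarrow> ennreal"
  assumes [measurable]: "\<And>i. f i \<in> borel_measurable borel"
  shows "(\<integral>\<^sup>+x. (\<Prod>i\<in>UNIV. f i (x $ i)) \<partial>(lborel :: (real^'n) measure)) = (\<Prod>i\<in>UNIV. \<integral>\<^sup>+t. f i t \<partial>lborel)"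
proof -
  have inj: "inj (\<lambda>i::'n. axis i (1::real))" by (auto simp: inj_on_def axis_eq_axis)
  have B: "(Basis :: (real^'n) set) = range (\<lambda>i. axis i 1)" by (auto simp: Basis_vec_def)
  define h :: "real^'n \<Rightarrow> real \<Rightarrow> ennreal" where "h b = f (inv (\<lambda>i. axis i 1) b)" for b
  have h: "h (axis i 1) = f i" for i
    unfolding h_def by (simp add: inv_f_f[OF inj])
  have "(\<integral>\<^sup>+x. (\<Prod>b\<in>Basis. h b (x \<bullet> b)) \<partial>(lborel :: (real^'n) measure)) = (\<Prod>b\<in>Basis. \<integral>\<^sup>+t. h b t \<partial>lborel)"
    by (rule nn_integral_lborel_prod) (auto simp: h_def)
  then show ?thesis
    unfolding B by (subst (asm) (1 2) prod.reindex) (auto simp: h inner_axis inj)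
qed

lemma nn_integral_normal_density:
  assumes "0 < \<sigma>"
  shows "(\<integral>\<^sup>+t. ennreal (normal_density m \<sigma> t) \<partial>lborel) = 1"
  using assms by (simp add: nn_integral_eq_integral)

lemma nn_integral_normal_density_square:
  assumes "0 < \<sigma>"
  shows "(\<integral>\<^sup>+t. ennreal (normal_density m \<sigma> t * (t - c)\<^sup>2) \<partial>lborel) = ennreal (\<sigma>\<^sup>2 + (m - c)\<^sup>2)"
proof -
  \<comment> \<open>The square is expanded about the mean \<open>m\<close>, where the moments of
    order 2, 1, 0 are \<open>\<sigma>\<^sup>2\<close>, 0 and 1.\<close>
  have "has_bochner_integral lborel (\<lambda>t. normal_density m \<sigma> t * (t - m)\<^sup>2 
     + 2 * (m - c) * (normal_density m \<sigma> t * (t - m)) + (m - c)\<^sup>2 * (normal_density m \<sigma> t)) (\<sigma>\<^sup>2 + 2 * (m - c) * 0 + (m - c)\<^sup>2 * 1)"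
    using normal_moment_even[OF assms, of m 1] normal_moment_odd[OF assms, of m 0] normal_moment_even[OF assms, of m 0]
    by (intro has_bochner_integral_add has_bochner_integral_mult_right) auto
  then have "has_bochner_integral lborel (\<lambda>t. normal_density m \<sigma> t * (t - c)\<^sup>2) (\<sigma>\<^sup>2 + (m - c)\<^sup>2)"
    by (rule has_bochner_integral_cong[THEN iffD1, rotated -1]) (auto simp: power2_eq_square algebra_simps)
  then show ?thesis
    by (simp add: has_bochner_integral_iff nn_integral_eq_integral)
qed

section \<open>The Gaussian source in rotated coordinates\<close>

locale gaussian_source =
  fixes Theta :: "real^'n^'n" and lam :: "real^'n"
  assumes orth: "orthogonal_matrix Theta" and lam_pos: "0 < lam $ i"
begin

definition src :: "(real^'n) measure" where
  "src = gaussian_measure (transpose Theta ** diag_mat lam ** Theta)"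

definition coord :: "'n \<Rightarrow> real^'n \<Rightarrow> real" where
  "coord i x = (Theta *v x) $ i"

lemma Theta_inverse: "transpose Theta ** Theta = mat 1" "Theta ** transpose Theta = mat 1"
  using orth by (auto simp: orthogonal_matrix_def)

lemma borel_measurable_coord [measurable]: "coord i \<in> borel_measurable borel"
  unfolding coord_def[abs_def]
  by (intro borel_measurable_continuous_onI continuous_on_component matrix_vector_mult_linear_continuous_on)

lemma coord_diff: "coord i (x - y) = coord i x - coord i y"
  by (simp add: coord_def matrix_vector_mult_diff_distrib)

lemma norm_sq_coord: "(norm x)\<^sup>2 = (\<Sum>i\<in>UNIV. (coord i x)\<^sup>2)"
proof -
  have "norm (Theta *v x) = norm x"
    using orth orthogonal_transformation_norm[of "(*v) Theta" x] by (simp add: orthogonal_transformation_matrix)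
  then have "(norm x)\<^sup>2 = (Theta *v x) \<bullet> (Theta *v x)"
    by (metis power2_norm_eq_inner)
  then show ?thesis
    by (simp add: inner_vec_def coord_def power2_eq_square)
qed

text \<open>Orthogonality makes the determinant the product of the eigenvalues and turns the
  quadratic form into a weighted sum of squared coordinates, so the joint density factors.\<close>

lemma src_eq:
  "src = density lborel (\<lambda>x. ennreal (\<Prod>i\<in>UNIV. normal_density 0 (sqrt (lam $ i)) (coord i x)))"
proof -
  define S where "S = transpose Theta ** diag_mat lam ** Theta"
  define R where "R = transpose Theta ** diag_mat (\<chi> i. 1 / lam $ i) ** Theta"
  have dm: "diag_mat lam ** diag_mat (\<chi> i. 1 / lam $ i) = mat 1"
       "diag_mat (\<chi> i. 1 / lam $ i) ** diag_mat lam = mat 1"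
    using lam_pos by (auto simp: diag_mat_def matrix_matrix_mult_def mat_def vec_eq_iff less_imp_neq[symmetric] if_distrib[of "\<lambda>x. x * _"] cong: if_cong)
  have SR: "S ** R = mat 1"
  proof -
    have "S ** R = transpose Theta ** (diag_mat lam ** ((Theta ** transpose Theta) ** diag_mat (\<chi> i. 1 / lam $ i))) ** Theta"
      unfolding S_def R_def by (simp add: matrix_mul_assoc)
    then show ?thesis by (simp add: Theta_inverse dm)
  qed
  have RS: "R ** S = mat 1"
  proof -
    have "R ** S = transpose Theta ** (diag_mat (\<chi> i. 1 / lam $ i) ** ((Theta ** transpose Theta) ** diag_mat lam)) ** Theta"
      unfolding S_def R_def by (simp add: matrix_mul_assoc)
    then show ?thesis by (simp add: Theta_inverse dm)
  qed
  \<comment> \<open>\<open>matrix_inv\<close> chooses a two-sided inverse; \<open>R\<close>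
    witnesses that one exists, and uniqueness of inverses identifies the two.\<close>
  have inv: "matrix_inv S = R"
  proof -
    have "S ** matrix_inv S = mat 1 \<and> matrix_inv S ** S = mat 1"
      unfolding matrix_inv_def by (rule someI[of _ R]) (simp add: SR RS)
    then show ?thesis
      by (metis SR matrix_mul_assoc matrix_mul_lid matrix_mul_rid)
  qed
  have "det (transpose Theta) * det Theta = 1"
    using Theta_inverse(1) by (metis det_I det_mul)
  then have "det S = det (diag_mat lam)"
    unfolding S_def by (simp add: det_mul ac_simps)
  also have "\<dots> = (\<Prod>i\<in>UNIV. lam $ i)"
    by (subst det_diagonal) (auto simp: diag_mat_def)
  finally have det: "det S = (\<Prod>i\<in>UNIV. lam $ i)" .
  have quad: "x \<bullet> (R *v x) = (\<Sum>i\<in>UNIV. (coord i x)\<^sup>2 / lam $ i)" for x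
  proof -
    have "x \<bullet> (R *v x) = (Theta *v x) \<bullet> (diag_mat (\<chi> i. 1 / lam $ i) *v (Theta *v x))"
      unfolding R_def by (metis (no_types) dot_lmul_matrix matrix_vector_mul_assoc transpose_matrix_vector transpose_transpose)
    also have "\<dots> = (\<Sum>i\<in>UNIV. (coord i x)\<^sup>2 / lam $ i)"
      by (simp add: inner_vec_def diag_mat_def matrix_vector_mult_def[of "\<chi> i j. _ i j"] coord_def power2_eq_square
        if_distrib[of "\<lambda>x. x * _"] cong: if_cong)
    finally show ?thesis .
  qed
  have dens: "(2 * pi) powr (- real CARD('n) / 2) / sqrt (det S) * exp (- (x \<bullet> (matrix_inv S *v x)) / 2)
     = (\<Prod>i\<in>UNIV. normal_density 0 (sqrt (lam $ i)) (coord i x))" for x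
  proof -
    have "(2 * pi) powr (- real CARD('n) / 2) = inverse (((2 * pi) powr (1/2)) powr real CARD('n))"
      by (subst powr_powr) (simp add: powr_minus)
    also have "\<dots> = inverse (sqrt (2 * pi) ^ CARD('n))"
      by (simp add: powr_half_sqrt powr_realpow)
    also have "\<dots> = (\<Prod>i\<in>(UNIV::'n set). inverse (sqrt (2 * pi)))"
      by (simp add: power_inverse)
    finally have 1: "(2 * pi) powr (- real CARD('n) / 2) = \<dots>" .
    have 2: "sqrt (\<Prod>i\<in>UNIV. lam $ i) = (\<Prod>i\<in>UNIV. sqrt (lam $ i))"
      by (induction rule: finite_induct[OF finite]) (simp_all add: real_sqrt_mult)
    have 3: "exp (- (\<Sum>i\<in>UNIV. (coord i x)\<^sup>2 / lam $ i) / 2) = (\<Prod>i\<in>UNIV. exp (- ((coord i x)\<^sup>2 / lam $ i) / 2))"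
      by (simp add: exp_sum[symmetric] sum_divide_distrib sum_negf)
    show ?thesis
      unfolding inv quad det 1 2 3 prod_dividef[symmetric] prod.distrib[symmetric]
      using lam_pos
      by (intro prod.cong refl) (simp add: normal_density_def real_sqrt_mult field_simps less_imp_le)
  qed
  show ?thesis
    unfolding src_def gaussian_measure_def S_def[symmetric] dens ..
qed

lemma sets_src [measurable_cong]: "sets src = sets borel"
  by (simp add: src_eq)

lemma space_src [simp]: "space src = UNIV"
  by (simp add: src_eq)

text \<open>Independence of the coordinates in integral form: rotation invariance of
  \<open>lborel\<close> removes \<open>Theta\<close>, and the integrand then separates. Later
  expectations under the source reduce to one-dimensional integrals through it.\<close>

lemma nn_integral_src_prod:
  fixes h :: "'n \<Rightarrow> real \<Rightarrow> ennreal"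
  assumes [measurable]: "\<And>i. h i \<in> borel_measurable borel"
  shows "(\<integral>\<^sup>+x. (\<Prod>i\<in>UNIV. h i (coord i x)) \<partial>src)
       = (\<Prod>i\<in>UNIV. \<integral>\<^sup>+t. ennreal (normal_density 0 (sqrt (lam $ i)) t) * h i t \<partial>lborel)"
proof -
  have "(\<integral>\<^sup>+x. (\<Prod>i\<in>UNIV. h i (coord i x)) \<partial>src)
     = (\<integral>\<^sup>+x. (\<Prod>i\<in>UNIV. ennreal (normal_density 0 (sqrt (lam $ i)) ((Theta *v x) $ i)) * h i ((Theta *v x) $ i)) \<partial>lborel)"
    unfolding src_eq
    by (subst nn_integral_density) (simp_all add: prod_ennreal[symmetric] prod.distrib coord_def[symmetric])
  also have "\<dots> = (\<integral>\<^sup>+y. (\<Prod>i\<in>UNIV. ennreal (normal_density 0 (sqrt (lam $ i)) (y $ i)) * h i (y $ i)) \<partial>distr lborel borel (\<lambda>x. Theta *v x))"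
    by (subst nn_integral_distr) auto
  also have "\<dots> = (\<Prod>i\<in>UNIV. \<integral>\<^sup>+t. ennreal (normal_density 0 (sqrt (lam $ i)) t) * h i t \<partial>lborel)"
    unfolding lborel_distr_orthogonal_matrix[OF orth]
    by (rule nn_integral_lborel_prod_cart[where f="\<lambda>i t. ennreal (normal_density 0 (sqrt (lam $ i)) t) * h i t"]) simp
  finally show ?thesis .
qed

end

section \<open>Likelihood ratio of the backward Gaussian channel\<close>

text \<open>This is \<open>ln u \<le> u - 1\<close> at \<open>u = w / x\<close>. Besides the
  variational bound it yields, at \<open>w = 1\<close>, nonnegativity of the integrand of mutual
  information.\<close>

lemma fenchel_entropy:
  fixes x w :: real
  assumes "0 \<le> x" "0 < w"
  shows "x * ln w - w \<le> x * ln x - x"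
proof (cases "x = 0")
  case False
  with assms have x: "0 < x" by simp
  have "x * ln (w / x) \<le> x * (w / x - 1)"
    using x assms by (intro mult_left_mono ln_le_minus_one) auto
  then show ?thesis
    using x assms by (simp add: ln_div algebra_simps)
qed (use assms in simp)

text \<open>\<open>ennreal\<close> sends negative values to 0, so the right side integrates the
  positive part of \<open>h\<close>. The converse uses this to compare a trial integrand of varying
  sign with the nonnegative one of \<open>mutual_info\<close>.\<close>

lemma ennreal_integral_le_nn_integral:
  fixes h :: "'a \<Rightarrow> real"
  assumes "integrable M h"
  shows "ennreal (integral\<^sup>L M h) \<le> (\<integral>\<^sup>+z. ennreal (h z) \<partial>M)"
proof -
  have "ennreal (integral\<^sup>L M h) \<le> ennreal (\<integral>z. max 0 (h z) \<partial>M)"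
    using assms by (intro ennreal_leI integral_mono) auto
  also have "\<dots> = (\<integral>\<^sup>+z. ennreal (max 0 (h z)) \<partial>M)"
    using assms by (intro nn_integral_eq_integral[symmetric]) auto
  also have "\<dots> = (\<integral>\<^sup>+z. ennreal (h z) \<partial>M)"
    by (intro nn_integral_cong) (simp add: max_def ennreal_neg)
  finally show ?thesis .
qed

section \<open>Square-integrable functions and scalar Gaussian densities\<close>

lemma integrable_mult_square_integrable:
  fixes X Y :: "'a \<Rightarrow> real"
  assumes [measurable]: "X \<in> borel_measurable M" "Y \<in> borel_measurable M"
    and "integrable M (\<lambda>z. (X z)\<^sup>2)" "integrable M (\<lambda>z. (Y z)\<^sup>2)"
  shows "integrable M (\<lambda>z. X z * Y z)"
proof (rule Bochner_Integration.integrable_bound)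
  show "integrable M (\<lambda>z. (X z)\<^sup>2 + (Y z)\<^sup>2)" using assms by simp
  have "\<bar>X z * Y z\<bar> \<le> (X z)\<^sup>2 + (Y z)\<^sup>2" for z
    using sum_squares_bound[of "\<bar>X z\<bar>" "\<bar>Y z\<bar>"] mult_nonneg_nonneg[OF abs_ge_zero[of "X z"] abs_ge_zero[of "Y z"]]
    unfolding abs_mult power2_abs by linarith
  then show "AE z in M. norm (X z * Y z) \<le> norm ((X z)\<^sup>2 + (Y z)\<^sup>2)" by simp
qed simp

lemma Cauchy_Schwarz_integral:
  fixes X Y :: "'a \<Rightarrow> real"
  assumes [measurable]: "X \<in> borel_measurable M" "Y \<in> borel_measurable M"
    and X: "integrable M (\<lambda>z. (X z)\<^sup>2)" and Y: "integrable M (\<lambda>z. (Y z)\<^sup>2)"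
  shows "(\<integral>z. X z * Y z \<partial>M)\<^sup>2 \<le> (\<integral>z. (X z)\<^sup>2 \<partial>M) * (\<integral>z. (Y z)\<^sup>2 \<partial>M)"
proof -
  define A B C where "A = (\<integral>z. (X z)\<^sup>2 \<partial>M)" and "B = (\<integral>z. (Y z)\<^sup>2 \<partial>M)"
    and "C = (\<integral>z. X z * Y z \<partial>M)"
  \<comment> \<open>The claim is this quadratic evaluated at its minimizer \<open>- C / A\<close>.
    For \<open>A = 0\<close> it is affine in \<open>t\<close>, and if \<open>C \<noteq> 0\<close>
    then \<open>t = - (B + 1) / (2 * C)\<close> would give it the value -1.\<close>
  have quad: "0 \<le> t\<^sup>2 * A + 2 * t * C + B" for t
  proof -
    have "0 \<le> (\<integral>z. (t * X z + Y z)\<^sup>2 \<partial>M)" by simp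
    also have "\<dots> = (\<integral>z. t\<^sup>2 * (X z)\<^sup>2 + 2 * t * (X z * Y z) + (Y z)\<^sup>2 \<partial>M)"
      by (intro Bochner_Integration.integral_cong) (auto simp: power2_eq_square algebra_simps)
    also have "\<dots> = t\<^sup>2 * A + 2 * t * C + B"
      using X Y integrable_mult_square_integrable[OF assms] by (simp add: A_def B_def C_def)
    finally show ?thesis .
  qed
  have "C\<^sup>2 \<le> A * B"
  proof (cases "A = 0")
    case True
    have "C = 0"
    proof (rule ccontr)
      assume "C \<noteq> 0"
      then show False using quad[of "- (B + 1) / (2 * C)"] True by (simp add: field_simps)
    qed
    with True show ?thesis by simp
  next
    case False
    then have "0 < A" by (simp add: A_def less_le)
    then show ?thesis using quad[of "- C / A"] by (simp add: power2_eq_square field_simps)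
  qed
  then show ?thesis by (simp add: A_def B_def C_def)
qed

lemma ln_normal_density:
  assumes "0 < v"
  shows "ln (normal_density m (sqrt v) t) = - ln (2 * pi) / 2 - ln v / 2 - (t - m)\<^sup>2 / (2 * v)"
  using assms unfolding normal_density_def by (simp add: ln_mult ln_div ln_sqrt field_simps)

text \<open>Reversibility of this pair density replaces a Gaussian convolution in computing the source marginal.\<close>
lemma normal_density_reversible:
  assumes "0 < v" "0 < l" "r\<^sup>2 * l + v = l"
  shows "normal_density 0 (sqrt l) t * normal_density (r * t) (sqrt v) y
    = normal_density 0 (sqrt l) y * normal_density (r * y) (sqrt v) t"
proof -
  have "- t\<^sup>2 / (2 * l) - (y - r * t)\<^sup>2 / (2 * v) = - y\<^sup>2 / (2 * l) - (t - r * y)\<^sup>2 / (2 * v)"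
  proof -
    have v: "v = l - r\<^sup>2 * l" using assms(3) by simp
    \<comment> \<open>With \<open>v = l * (1 - r\<^sup>2)\<close> both sides become
      \<open>l * (t\<^sup>2 - 2 * r * t * y + y\<^sup>2)\<close>, which is symmetric in
      \<open>t\<close> and \<open>y\<close>.\<close>
    have "t\<^sup>2 * v + (y - r * t)\<^sup>2 * l = y\<^sup>2 * v + (t - r * y)\<^sup>2 * l"
      unfolding v by (simp add: power2_eq_square algebra_simps)
    then show ?thesis using assms(1,2) by (simp add: field_simps)
  qed
  then have "exp (- t\<^sup>2 / (2 * l)) * exp (- (y - r * t)\<^sup>2 / (2 * v)) = exp (- y\<^sup>2 / (2 * l)) * exp (- (t - r * y)\<^sup>2 / (2 * v))"
    by (simp add: exp_add[symmetric])
  then show ?thesis using assms unfolding normal_density_def by simp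
qed

context gaussian_source
begin

text \<open>For positive \<open>g\<close>, the density relative to the source law of the kernel that
  draws source coordinate \<open>i\<close> from a normal law with mean \<open>a i\<close> times the
  reconstruction coordinate and variance \<open>g i\<close>. Conditioning on the reconstruction
  makes it integrate to one over the source for every gain \<open>a\<close>.\<close>

definition channel :: "('n \<Rightarrow> real) \<Rightarrow> ('n \<Rightarrow> real) \<Rightarrow> (real^'n) \<times> (real^'n) \<Rightarrow> real" where
  "channel a g z = (\<Prod>i\<in>UNIV. normal_density (a i * coord i (snd z)) (sqrt (g i)) (coord i (fst z))
     / normal_density 0 (sqrt (lam $ i)) (coord i (fst z)))"

lemma borel_measurable_channel [measurable]:
  "channel a g \<in> borel_measurable (borel \<Otimes>\<^sub>M borel)"
  unfolding channel_def[abs_def] normal_density_def by measurable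

lemma channel_pos: "(\<And>i. 0 < g i) \<Longrightarrow> 0 < channel a g z"
  unfolding channel_def using lam_pos by (intro prod_pos) (simp add: normal_density_pos)

text \<open>The factors \<open>2 * pi\<close> cancel in the ratio and a quadratic polynomial in the
  coordinates remains, so expectations of it depend on second moments only.\<close>

lemma ln_channel:
  assumes "\<And>i. 0 < g i"
  shows "ln (channel a g z) = (\<Sum>i\<in>UNIV. ln (lam $ i / g i) / 2
     - (coord i (fst z) - a i * coord i (snd z))\<^sup>2 / (2 * g i) + (coord i (fst z))\<^sup>2 / (2 * lam $ i))"
proof -
  have "ln (channel a g z) = (\<Sum>i\<in>UNIV. ln (normal_density (a i * coord i (snd z)) (sqrt (g i)) (coord i (fst z))
     / normal_density 0 (sqrt (lam $ i)) (coord i (fst z))))"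
    unfolding channel_def using assms lam_pos
    by (intro ln_prod) (simp_all add: normal_density_pos less_imp_neq[symmetric])
  also have "\<dots> = (\<Sum>i\<in>UNIV. ln (lam $ i / g i) / 2
     - (coord i (fst z) - a i * coord i (snd z))\<^sup>2 / (2 * g i) + (coord i (fst z))\<^sup>2 / (2 * lam $ i))"
  proof (intro sum.cong refl)
    fix i
    have "0 < lam $ i" "0 < g i" using assms lam_pos by auto
    then show "ln (normal_density (a i * coord i (snd z)) (sqrt (g i)) (coord i (fst z))
     / normal_density 0 (sqrt (lam $ i)) (coord i (fst z))) = ln (lam $ i / g i) / 2
     - (coord i (fst z) - a i * coord i (snd z))\<^sup>2 / (2 * g i) + (coord i (fst z))\<^sup>2 / (2 * lam $ i)"
      by (simp add: ln_div normal_density_pos[THEN less_imp_neq, symmetric] ln_normal_density field_simps)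
  qed
  finally show ?thesis .
qed

text \<open>The denominator of the ratio cancels the source density, leaving the normal laws
  conditioned on the reconstruction \<open>xh\<close>.\<close>

lemma nn_integral_channel_prod:
  fixes h :: "'n \<Rightarrow> real \<Rightarrow> ennreal"
  assumes [measurable]: "\<And>i. h i \<in> borel_measurable borel"
  shows "(\<integral>\<^sup>+x. ennreal (channel a g (x, xh)) * (\<Prod>i\<in>UNIV. h i (coord i x)) \<partial>src)
       = (\<Prod>i\<in>UNIV. \<integral>\<^sup>+t. ennreal (normal_density (a i * coord i xh) (sqrt (g i)) t) * h i t \<partial>lborel)"
proof -
  let ?r = "\<lambda>i t. ennreal (normal_density (a i * coord i xh) (sqrt (g i)) t / normal_density 0 (sqrt (lam $ i)) t)"
  have "(\<integral>\<^sup>+x. ennreal (channel a g (x, xh)) * (\<Prod>i\<in>UNIV. h i (coord i x)) \<partial>src)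
    = (\<integral>\<^sup>+x. (\<Prod>i\<in>UNIV. ?r i (coord i x) * h i (coord i x)) \<partial>src)"
    by (simp add: channel_def prod_ennreal[symmetric] prod.distrib)
  also have "\<dots> = (\<Prod>i\<in>UNIV. \<integral>\<^sup>+t. ennreal (normal_density 0 (sqrt (lam $ i)) t) * (?r i t * h i t) \<partial>lborel)"
    by (rule nn_integral_src_prod) measurable
  also have "\<dots> = (\<Prod>i\<in>UNIV. \<integral>\<^sup>+t. ennreal (normal_density (a i * coord i xh) (sqrt (g i)) t) * h i t \<partial>lborel)"
  proof (intro prod.cong nn_integral_cong refl)
    fix i t
    have "0 < normal_density 0 (sqrt (lam $ i)) t" using lam_pos by (simp add: normal_density_pos)
    then show "ennreal (normal_density 0 (sqrt (lam $ i)) t) * (?r i t * h i t)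
      = ennreal (normal_density (a i * coord i xh) (sqrt (g i)) t) * h i t"
      by (simp add: mult.assoc[symmetric] ennreal_mult[symmetric])
  qed
  finally show ?thesis .
qed

lemma nn_integral_channel_fst:
  assumes "\<And>i. 0 < g i"
  shows "(\<integral>\<^sup>+x. ennreal (channel a g (x, xh)) \<partial>src) = 1"
  using nn_integral_channel_prod[of "\<lambda>_ _. 1" a g xh] assms by (simp add: nn_integral_normal_density)

lemma nn_integral_channel_square:
  assumes "\<And>i. 0 < g i"
  shows "(\<integral>\<^sup>+x. ennreal (channel a g (x, xh) * (coord i x - c)\<^sup>2) \<partial>src)
    = ennreal (g i + (a i * coord i xh - c)\<^sup>2)"
proof -
  \<comment> \<open>A product test function with a single nontrivial factor; the other coordinates
    integrate to one.\<close>
  let ?h = "\<lambda>j t. if j = i then ennreal ((t - c)\<^sup>2) else 1"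
  have "(\<integral>\<^sup>+x. ennreal (channel a g (x, xh) * (coord i x - c)\<^sup>2) \<partial>src)
    = (\<integral>\<^sup>+x. ennreal (channel a g (x, xh)) * (\<Prod>j\<in>UNIV. ?h j (coord j x)) \<partial>src)"
    using assms by (simp add: ennreal_mult channel_pos less_imp_le)
  also have "\<dots> = (\<Prod>j\<in>UNIV. \<integral>\<^sup>+t. ennreal (normal_density (a j * coord j xh) (sqrt (g j)) t) * ?h j t \<partial>lborel)"
    by (rule nn_integral_channel_prod) measurable
  also have "\<dots> = (\<Prod>j\<in>UNIV. if j = i then ennreal (g i + (a i * coord i xh - c)\<^sup>2) else 1)"
    using assms nn_integral_normal_density_square[of "sqrt (g i)" "a i * coord i xh" c]
    by (intro prod.cong refl) (auto simp: ennreal_mult[symmetric] nn_integral_normal_density less_imp_le)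
  finally show ?thesis by simp
qed

text \<open>Zero gain and conditional variances equal to \<open>lam\<close> describe a
  reconstruction independent of the source. In this case the channel integrals give the total mass
  and the second moments of the source, with an arbitrary value in the reconstruction slot.\<close>

lemma channel_eq_1: "channel (\<lambda>_. 0) (($) lam) z = 1"
  unfolding channel_def using lam_pos
  by (intro prod.neutral) (simp add: normal_density_pos less_imp_neq[symmetric])

lemma prob_space_src: "prob_space src"
  using nn_integral_channel_fst[of "($) lam" "\<lambda>_. 0"] lam_pos
  by (intro prob_spaceI) (simp add: channel_eq_1)

lemma nn_integral_src_square: "(\<integral>\<^sup>+x. ennreal ((coord i x)\<^sup>2) \<partial>src) = ennreal (lam $ i)"
  using nn_integral_channel_square[of "($) lam" "\<lambda>_. 0" undefined i 0] lam_pos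
  by (simp add: channel_eq_1)

text \<open>Here the ratio is integrated over the reconstruction, a scaled copy \<open>T x'\<close>
  of the source. Hypothesis \<open>r\<close> says that explained variance plus noise is
  \<open>lam\<close>, so the kernel with gain \<open>a i * s i\<close> is reversible for the source
  density; exchanging the two arguments turns each factor into a normal density of mass one.\<close>

lemma nn_integral_channel_snd:
  assumes g: "\<And>i. 0 < g i"
    and T: "\<And>i x. coord i (T x) = s i * coord i x"
    and r: "\<And>i. (a i * s i)\<^sup>2 * lam $ i + g i = lam $ i"
  shows "(\<integral>\<^sup>+x'. ennreal (channel a g (x, T x')) \<partial>src) = 1"
proof -
  let ?h = "\<lambda>i t. ennreal (normal_density (a i * s i * t) (sqrt (g i)) (coord i x) / normal_density 0 (sqrt (lam $ i)) (coord i x))"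
  have "(\<integral>\<^sup>+x'. ennreal (channel a g (x, T x')) \<partial>src) = (\<integral>\<^sup>+x'. (\<Prod>i\<in>UNIV. ?h i (coord i x')) \<partial>src)"
    by (simp add: channel_def prod_ennreal T mult.assoc)
  also have "\<dots> = (\<Prod>i\<in>UNIV. \<integral>\<^sup>+t. ennreal (normal_density 0 (sqrt (lam $ i)) t) * ?h i t \<partial>lborel)"
    by (rule nn_integral_src_prod) (simp add: normal_density_def)
  also have "\<dots> = (\<Prod>i\<in>(UNIV::'n set). 1)"
  proof (intro prod.cong refl)
    fix i
    have pos: "0 < normal_density 0 (sqrt (lam $ i)) (coord i x)" using lam_pos by (simp add: normal_density_pos)
    have "ennreal (normal_density 0 (sqrt (lam $ i)) t) * ?h i t
       = ennreal (normal_density (a i * s i * coord i x) (sqrt (g i)) t)" for t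
      using normal_density_reversible[OF g lam_pos r, of i t "coord i x"] pos
      by (simp add: ennreal_mult[symmetric])
    then show "(\<integral>\<^sup>+t. ennreal (normal_density 0 (sqrt (lam $ i)) t) * ?h i t \<partial>lborel) = 1"
      using g[of i] by (simp add: nn_integral_normal_density)
  qed
  finally show ?thesis by simp
qed

end

section \<open>Converse\<close>

lemma enn2ereal_ennreal_leD:
  assumes "enn2ereal (ennreal s) \<le> ereal c"
  shows "s \<le> c"
proof (cases "0 \<le> s")
  case True
  then show ?thesis using assms by (simp add: enn2ereal_ennreal)
next
  case False
  then show ?thesis using assms by (simp add: ennreal_neg zero_ennreal.rep_eq)
qed

context gaussian_source
begin

text \<open>The squared norm is a sum over rotated coordinates, so only second moments enter. It
  serves both the distortion of a joint law and the cost of a coupling.\<close>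

lemma nn_integral_dist_sq:
  assumes sets[measurable_cong]: "sets M = sets (borel \<Otimes>\<^sub>M borel)"
    and X: "\<And>i. integrable M (\<lambda>z. (coord i (fst z))\<^sup>2)"
    and Y: "\<And>i. integrable M (\<lambda>z. (coord i (snd z))\<^sup>2)"
  shows "(\<integral>\<^sup>+z. ennreal ((norm (fst z - snd z))\<^sup>2) \<partial>M)
    = ennreal (\<Sum>i\<in>UNIV. (\<integral>z. (coord i (fst z))\<^sup>2 \<partial>M)
        - 2 * (\<integral>z. coord i (fst z) * coord i (snd z) \<partial>M) + (\<integral>z. (coord i (snd z))\<^sup>2 \<partial>M))"
proof -
  have XY: "integrable M (\<lambda>z. coord i (fst z) * coord i (snd z))" for i
    by (intro integrable_mult_square_integrable X Y) measurable
  have eq: "(norm (fst z - snd z))\<^sup>2 = (\<Sum>i\<in>UNIV. (coord i (fst z))\<^sup>2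
      - 2 * (coord i (fst z) * coord i (snd z)) + (coord i (snd z))\<^sup>2)" for z
    unfolding norm_sq_coord coord_diff by (simp add: power2_diff algebra_simps)
  have int: "integrable M (\<lambda>z. (norm (fst z - snd z))\<^sup>2)"
    unfolding eq using X Y XY by simp
  have "(\<integral>z. (norm (fst z - snd z))\<^sup>2 \<partial>M) = (\<Sum>i\<in>UNIV. (\<integral>z. (coord i (fst z))\<^sup>2 \<partial>M)
        - 2 * (\<integral>z. coord i (fst z) * coord i (snd z) \<partial>M) + (\<integral>z. (coord i (snd z))\<^sup>2 \<partial>M))"
    unfolding eq using X Y XY by simp
  then show ?thesis
    using int by (simp add: nn_integral_eq_integral)
qed

lemma marginal_square_moment:
  assumes [measurable]: "p \<in> M \<rightarrow>\<^sub>M borel" and "distr M borel p = src"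
  shows "integrable M (\<lambda>z. (coord i (p z))\<^sup>2)" "(\<integral>z. (coord i (p z))\<^sup>2 \<partial>M) = lam $ i"
proof -
  have "(\<integral>\<^sup>+z. ennreal ((coord i (p z))\<^sup>2) \<partial>M) = (\<integral>\<^sup>+x. ennreal ((coord i x)\<^sup>2) \<partial>distr M borel p)"
    by (subst nn_integral_distr) auto
  also have "\<dots> = ennreal (lam $ i)" by (simp add: assms nn_integral_src_square)
  finally have *: "(\<integral>\<^sup>+z. ennreal ((coord i (p z))\<^sup>2) \<partial>M) = ennreal (lam $ i)" .
  have "integrable M (\<lambda>z. (coord i (p z))\<^sup>2) \<and> (\<integral>z. (coord i (p z))\<^sup>2 \<partial>M) = lam $ i"
    using * lam_pos[of i] by (subst (asm) nn_integral_eq_integrable) auto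
  then show "integrable M (\<lambda>z. (coord i (p z))\<^sup>2)" "(\<integral>z. (coord i (p z))\<^sup>2 \<partial>M) = lam $ i"
    by auto
qed

text \<open>In every coupling Cauchy-Schwarz bounds the cross moment of coordinate \<open>i\<close>
  by \<open>sqrt (lam $ i * lh i)\<close>, which completes the square. Only the second moments of
  \<open>\<nu>\<close> matter, so it may be any law, Gaussian or not.\<close>

lemma W2sq_src_ge:
  assumes sq: "\<And>i. integrable \<nu> (\<lambda>y. (coord i y)\<^sup>2)" and lh: "\<And>i. (\<integral>y. (coord i y)\<^sup>2 \<partial>\<nu>) = lh i"
  shows "ennreal (\<Sum>i\<in>UNIV. (sqrt (lam $ i) - sqrt (lh i))\<^sup>2) \<le> W2sq src \<nu>"
  unfolding W2sq_def
proof (rule INF_greatest)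
  fix \<pi> assume "\<pi> \<in> couplings src \<nu>"
  then have sets[measurable_cong]: "sets \<pi> = sets (borel \<Otimes>\<^sub>M borel)"
    and d1: "distr \<pi> borel fst = src" and d2: "distr \<pi> borel snd = \<nu>"
    by (auto simp: couplings_def)
  have lh0: "0 \<le> lh i" for i unfolding lh[symmetric] by simp
  have X: "integrable \<pi> (\<lambda>z. (coord i (fst z))\<^sup>2)" "(\<integral>z. (coord i (fst z))\<^sup>2 \<partial>\<pi>) = lam $ i" for i
    by (intro marginal_square_moment d1; measurable)+
  have Y: "integrable \<pi> (\<lambda>z. (coord i (snd z))\<^sup>2)" for i
    using sq[of i] unfolding d2[symmetric] by (subst (asm) integrable_distr_eq) auto
  have Y2: "(\<integral>z. (coord i (snd z))\<^sup>2 \<partial>\<pi>) = lh i" for i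
    using lh[of i] unfolding d2[symmetric] by (subst (asm) integral_distr) auto
  have "(sqrt (lam $ i) - sqrt (lh i))\<^sup>2 \<le> lam $ i
       - 2 * (\<integral>z. coord i (fst z) * coord i (snd z) \<partial>\<pi>) + lh i" for i
  proof -
    have "(\<integral>z. coord i (fst z) * coord i (snd z) \<partial>\<pi>)\<^sup>2 \<le> lam $ i * lh i"
      unfolding X(2)[symmetric] Y2[symmetric] by (intro Cauchy_Schwarz_integral X Y) measurable
    then have "(\<integral>z. coord i (fst z) * coord i (snd z) \<partial>\<pi>) \<le> sqrt (lam $ i * lh i)"
      by (rule real_le_rsqrt)
    then show ?thesis
      using lh0[of i] lam_pos[of i] by (simp add: power2_diff real_sqrt_mult)
  qed
  then show "ennreal (\<Sum>i\<in>UNIV. (sqrt (lam $ i) - sqrt (lh i))\<^sup>2)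
       \<le> (\<integral>\<^sup>+z. ennreal ((norm (fst z - snd z))\<^sup>2) \<partial>\<pi>)"
    unfolding nn_integral_dist_sq[OF sets X(1) Y] X(2) Y2 by (intro ennreal_leI sum_mono)
qed

text \<open>The term \<open>1 / 2\<close> is the source moment \<open>lam $ i\<close> divided by
  \<open>2 * lam $ i\<close>. It cancels the residual term exactly when \<open>g i\<close> equals
  the mean squared residual, leaving the rate.\<close>

lemma integrable_ln_channel:
  assumes sets[measurable_cong]: "sets J = sets (borel \<Otimes>\<^sub>M borel)" and J: "prob_space J"
    and X: "\<And>i. integrable J (\<lambda>z. (coord i (fst z))\<^sup>2)"
    and X2: "\<And>i. (\<integral>z. (coord i (fst z))\<^sup>2 \<partial>J) = lam $ i"
    and Y: "\<And>i. integrable J (\<lambda>z. (coord i (snd z))\<^sup>2)"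
    and g: "\<And>i. 0 < g i"
  shows "integrable J (\<lambda>z. ln (channel a g z))"
    and "(\<integral>z. ln (channel a g z) \<partial>J) = (\<Sum>i\<in>UNIV. ln (lam $ i / g i) / 2
      - (\<integral>z. (coord i (fst z) - a i * coord i (snd z))\<^sup>2 \<partial>J) / (2 * g i) + 1 / 2)"
    and "integrable J (\<lambda>z. (coord i (fst z) - a i * coord i (snd z))\<^sup>2)"
    and "(\<integral>z. (coord i (fst z) - a i * coord i (snd z))\<^sup>2 \<partial>J) = lam $ i
      - 2 * a i * (\<integral>z. coord i (fst z) * coord i (snd z) \<partial>J) + (a i)\<^sup>2 * (\<integral>z. (coord i (snd z))\<^sup>2 \<partial>J)"
proof -
  interpret prob_space J by fact
  have XY: "integrable J (\<lambda>z. coord i (fst z) * coord i (snd z))" for i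
    by (intro integrable_mult_square_integrable X Y) measurable
  have eq: "(coord i (fst z) - a i * coord i (snd z))\<^sup>2 = (coord i (fst z))\<^sup>2
    - 2 * a i * (coord i (fst z) * coord i (snd z)) + (a i)\<^sup>2 * (coord i (snd z))\<^sup>2" for i z
    by (simp add: power2_eq_square algebra_simps)
  show R: "integrable J (\<lambda>z. (coord i (fst z) - a i * coord i (snd z))\<^sup>2)" for i
    unfolding eq using X Y XY by simp
  show "(\<integral>z. (coord i (fst z) - a i * coord i (snd z))\<^sup>2 \<partial>J) = lam $ i
      - 2 * a i * (\<integral>z. coord i (fst z) * coord i (snd z) \<partial>J) + (a i)\<^sup>2 * (\<integral>z. (coord i (snd z))\<^sup>2 \<partial>J)"
    unfolding eq using X Y XY by (simp add: X2)
  show "integrable J (\<lambda>z. ln (channel a g z))"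
    unfolding ln_channel[where g=g, OF g] using X R by simp
  have "(\<integral>z. ln (channel a g z) \<partial>J) = (\<Sum>i\<in>UNIV. ln (lam $ i / g i) / 2
      - (\<integral>z. (coord i (fst z) - a i * coord i (snd z))\<^sup>2 \<partial>J) / (2 * g i) + lam $ i / (2 * lam $ i))"
    unfolding ln_channel[where g=g, OF g] using X R by (simp add: X2 prob_space)
  then show "(\<integral>z. ln (channel a g z) \<partial>J) = (\<Sum>i\<in>UNIV. ln (lam $ i / g i) / 2
      - (\<integral>z. (coord i (fst z) - a i * coord i (snd z))\<^sup>2 \<partial>J) / (2 * g i) + 1 / 2)"
    using lam_pos by (simp add: less_imp_neq[symmetric])
qed

text \<open>The pointwise Fenchel inequality with \<open>x\<close> the density of \<open>J\<close>
  with respect to the product \<open>Q\<close> of its marginals and \<open>w\<close> the channel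
  ratio, integrated over \<open>Q\<close>. The parameters \<open>a\<close> and \<open>g\<close> need
  not be matched to \<open>J\<close>; this freedom is used to exclude zero estimation
  errors.\<close>

lemma mutual_info_ge:
  assumes sets[measurable_cong]: "sets J = sets (borel \<Otimes>\<^sub>M borel)" and J: "prob_space J"
    and d1: "distr J borel fst = src"
    and Y: "\<And>i. integrable J (\<lambda>z. (coord i (snd z))\<^sup>2)"
    and g: "\<And>i. 0 < g i"
  shows "ennreal (\<integral>z. ln (channel a g z) \<partial>J) \<le> mutual_info J"
proof -
  interpret J: prob_space J by fact
  interpret S: prob_space src by (rule prob_space_src)
  define \<nu> where "\<nu> = distr J borel snd"
  have [measurable_cong]: "sets \<nu> = sets borel" by (simp add: \<nu>_def)
  interpret N: prob_space \<nu> unfolding \<nu>_def by (rule J.prob_space_distr) measurable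
  interpret Q: pair_prob_space src \<nu> ..
  define Q where "Q = src \<Otimes>\<^sub>M \<nu>"
  interpret QQ: prob_space Q unfolding Q_def by (rule Q.P.prob_space_axioms)
  have sQ[measurable_cong]: "sets Q = sets (borel \<Otimes>\<^sub>M borel)"
    unfolding Q_def by (intro sets_pair_measure_cong) (simp_all add: sets_src \<nu>_def)
  define f where "f z = enn2real (RN_deriv Q J z)" for z
  have MI: "mutual_info J = (if absolutely_continuous Q J
         then \<integral>\<^sup>+ z. ennreal (f z * ln (f z) - f z + 1) \<partial>Q else \<infinity>)"
    unfolding mutual_info_def Let_def f_def Q_def \<nu>_def d1 ..
  show ?thesis
  proof (cases "absolutely_continuous Q J")
    case False
    then show ?thesis by (simp add: MI)
  next
    case True
    have fm[measurable]: "f \<in> borel_measurable Q" unfolding f_def by measurable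
    have f0: "0 \<le> f z" for z by (simp add: f_def)
    have dens: "density Q (RN_deriv Q J) = J"
      by (rule QQ.density_RN_deriv[OF True]) (simp add: sets sQ)
    \<comment> \<open>Almost everywhere finiteness ensures that \<open>enn2real\<close> in the
      definition of \<open>mutual_info\<close> loses no mass.\<close>
    have fin: "AE z in Q. RN_deriv Q J z \<noteq> \<infinity>"
      by (rule QQ.RN_deriv_finite[OF _ True]) (simp_all add: sets sQ J.sigma_finite_measure_axioms)
    have Jf: "J = density Q (\<lambda>z. ennreal (f z))"
    proof -
      have "AE z in Q. RN_deriv Q J z = ennreal (f z)"
        using fin by eventually_elim (simp add: f_def less_top)
      then have "density Q (RN_deriv Q J) = density Q (\<lambda>z. ennreal (f z))"
        by (intro density_cong) auto
      then show ?thesis by (simp add: dens)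
    qed
    let ?p = "\<lambda>z. ln (channel a g z)"
    have X: "integrable J (\<lambda>z. (coord i (fst z))\<^sup>2)" "(\<integral>z. (coord i (fst z))\<^sup>2 \<partial>J) = lam $ i" for i
      by (intro marginal_square_moment d1; measurable)+
    have ip: "integrable J ?p" by (rule integrable_ln_channel[where g=g, OF sets J X Y g])
    have pm[measurable]: "?p \<in> borel_measurable Q" by measurable
    have i1: "integrable Q (\<lambda>z. f z * ?p z)"
      using ip f0 by (subst (asm) Jf, subst (asm) integrable_density) auto
    have i1': "(\<integral>z. f z * ?p z \<partial>Q) = (\<integral>z. ?p z \<partial>J)"
      using f0 by (subst Jf, subst integral_density) auto
    have "(\<integral>\<^sup>+z. ennreal (channel a g z) \<partial>Q) = (\<integral>\<^sup>+y. \<integral>\<^sup>+x. ennreal (channel a g (x, y)) \<partial>src \<partial>\<nu>)"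
      unfolding Q_def by (subst Q.nn_integral_snd[symmetric]) auto
    also have "\<dots> = ennreal 1"
      by (simp add: nn_integral_channel_fst g N.emeasure_space_1)
    finally have i2: "integrable Q (channel a g)" "(\<integral>z. channel a g z \<partial>Q) = 1"
      using channel_pos[of g, OF g] by (subst (asm) nn_integral_eq_integrable; auto simp: less_imp_le)+
    \<comment> \<open>The added \<open>- channel a g z + 1\<close> has integral zero over
      \<open>Q\<close>, since the ratio integrates to one over the source for each
      reconstruction.\<close>
    have "ennreal (\<integral>z. ?p z \<partial>J) = ennreal (\<integral>z. f z * ?p z - channel a g z + 1 \<partial>Q)"
      using i1 i2 by (simp add: i1' QQ.prob_space)
    also have "\<dots> \<le> (\<integral>\<^sup>+z. ennreal (f z * ?p z - channel a g z + 1) \<partial>Q)"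
      using i1 i2 by (intro ennreal_integral_le_nn_integral) simp
    also have "\<dots> \<le> (\<integral>\<^sup>+z. ennreal (f z * ln (f z) - f z + 1) \<partial>Q)"
      using fenchel_entropy[OF f0 channel_pos[of g, OF g]] by (intro nn_integral_mono ennreal_leI add_right_mono) auto
    also have "\<dots> = mutual_info J" using True by (simp add: MI)
    finally show ?thesis .
  qed
qed

text \<open>The witness pairs the second moments of the reconstruction with the errors of the best
  linear estimators of the source coordinates. Finiteness of the mutual information makes these
  errors strictly positive.\<close>

lemma ex_feasible_objective_le_mutual_info:
  assumes sets[measurable_cong]: "sets J = sets (borel \<Otimes>\<^sub>M borel)" and J: "prob_space J"
    and d1: "distr J borel fst = src"
    and D: "enn2ereal (\<integral>\<^sup>+ z. ennreal ((norm (fst z - snd z))\<^sup>2) \<partial>J) \<le> ereal D"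
    and P: "enn2ereal (W2sq src (distr J borel snd)) \<le> ereal P"
    and fin: "mutual_info J \<noteq> \<top>"
  shows "\<exists>z\<in>feasible lam D P. ennreal (objective lam z) \<le> mutual_info J"
proof -
  interpret J: prob_space J by fact
  have X: "integrable J (\<lambda>z. (coord i (fst z))\<^sup>2)" "(\<integral>z. (coord i (fst z))\<^sup>2 \<partial>J) = lam $ i" for i
    by (intro marginal_square_moment d1; measurable)+
  have "(\<integral>\<^sup>+ z. ennreal ((norm (fst z - snd z))\<^sup>2) \<partial>J) < \<infinity>"
    using D by (cases "(\<integral>\<^sup>+ z. ennreal ((norm (fst z - snd z))\<^sup>2) \<partial>J) = \<top>")
      (auto simp: top_ennreal.rep_eq top_ereal_def less_top)
  then have dI: "integrable J (\<lambda>z. (norm (fst z - snd z))\<^sup>2)"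
    by (intro integrableI_nonneg) auto
  have Y: "integrable J (\<lambda>z. (coord i (snd z))\<^sup>2)" for i
  proof (rule Bochner_Integration.integrable_bound)
    show "integrable J (\<lambda>z. 2 * (coord i (fst z))\<^sup>2 + 2 * (norm (fst z - snd z))\<^sup>2)"
      using X dI by simp
    have "(coord i (snd z))\<^sup>2 \<le> 2 * (coord i (fst z))\<^sup>2 + 2 * (norm (fst z - snd z))\<^sup>2" for z
    proof -
      have "(coord i (fst z - snd z))\<^sup>2 \<le> (norm (fst z - snd z))\<^sup>2"
        unfolding norm_sq_coord by (rule member_le_sum) auto
      \<comment> \<open>The right side minus the left is
        \<open>(2 * coord i (fst z) - coord i (snd z))\<^sup>2\<close>. Finite distortion thus gives
        the reconstruction finite second moments.\<close>
      moreover have "(coord i (snd z))\<^sup>2 \<le> 2 * (coord i (fst z))\<^sup>2 + 2 * (coord i (fst z - snd z))\<^sup>2"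
        using zero_le_power2[of "2 * coord i (fst z) - coord i (snd z)"]
        unfolding coord_diff by (simp add: power2_eq_square algebra_simps)
      ultimately show ?thesis by linarith
    qed
    then show "AE z in J. norm ((coord i (snd z))\<^sup>2) \<le> norm (2 * (coord i (fst z))\<^sup>2 + 2 * (norm (fst z - snd z))\<^sup>2)"
      by simp
  qed measurable
  define lh where "lh i = (\<integral>z. (coord i (snd z))\<^sup>2 \<partial>J)" for i
  define C where "C i = (\<integral>z. coord i (fst z) * coord i (snd z) \<partial>J)" for i
  \<comment> \<open>The least-squares coefficient. If \<open>lh i = 0\<close>, division by zero
    makes it 0, which is consistent because \<open>C i\<close> vanishes too.\<close>
  define a where "a i = C i / lh i" for i
  define \<gamma> where "\<gamma> i = (\<integral>z. (coord i (fst z) - a i * coord i (snd z))\<^sup>2 \<partial>J)" for i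
  have lh0: "0 \<le> lh i" for i unfolding lh_def by simp
  have CS: "(C i)\<^sup>2 \<le> lam $ i * lh i" for i
    unfolding C_def lh_def X(2)[symmetric] by (intro Cauchy_Schwarz_integral X Y) measurable
  have C0: "lh i = 0 \<Longrightarrow> C i = 0" for i using CS[of i] by simp
  have one: "\<And>i::'n. 0 < (1::real)" by simp
  have \<gamma>: "\<gamma> i = lam $ i - (C i)\<^sup>2 / lh i" for i
    unfolding \<gamma>_def integrable_ln_channel(4)[where g="\<lambda>_. 1" and a=a, OF sets J X Y one] C_def[symmetric] lh_def[symmetric]
    by (cases "lh i = 0") (auto simp: a_def C0 power2_eq_square field_simps)
  have \<gamma>0: "0 \<le> \<gamma> i" for i unfolding \<gamma>_def by simp
  have \<gamma>pos: "0 < \<gamma> k" for k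
  proof (rule ccontr)
    assume "\<not> 0 < \<gamma> k"
    then have \<gamma>k: "\<gamma> k = 0" using \<gamma>0[of k] by simp
    define m where "m = enn2real (mutual_info J)"
    have m: "mutual_info J = ennreal m" "0 \<le> m" using fin by (auto simp: m_def less_top)
    \<comment> \<open>A trial ratio informative only at \<open>k\<close>: the other coordinates
      contribute nothing, and the variance \<open>lam $ k * exp (- 2 * m)\<close> makes the log term
      equal to \<open>m\<close>. Since the residual at \<open>k\<close> is zero,
      \<open>1 / 2\<close> is left over and the bound \<open>m + 1 / 2\<close> exceeds the mutual
      information.\<close>
    define b where "b i = (if i = k then a k else 0)" for i
    define g where "g i = (if i = k then lam $ k * exp (- 2 * m) else lam $ i)" for i
    have g: "0 < g i" for i using lam_pos by (simp add: g_def)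
    have "(\<integral>z. ln (channel b g z) \<partial>J) = (\<Sum>i\<in>UNIV. ln (lam $ i / g i) / 2
      - (\<integral>z. (coord i (fst z) - b i * coord i (snd z))\<^sup>2 \<partial>J) / (2 * g i) + 1 / 2)"
      by (rule integrable_ln_channel[where g=g, OF sets J X Y g])
    also have "\<dots> = (\<Sum>i\<in>UNIV. if i = k then m + 1 / 2 else 0)"
    proof (intro sum.cong refl)
      fix i
      show "ln (lam $ i / g i) / 2 - (\<integral>z. (coord i (fst z) - b i * coord i (snd z))\<^sup>2 \<partial>J) / (2 * g i) + 1 / 2
        = (if i = k then m + 1 / 2 else 0)"
      proof (cases "i = k")
        case True
        have "lam $ k / (lam $ k * exp (- 2 * m)) = exp (2 * m)"
          using lam_pos[of k] by (simp add: exp_minus field_simps)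
        then show ?thesis using True \<gamma>k by (simp add: b_def g_def \<gamma>_def)
      next
        case False
        then show ?thesis using lam_pos[of i] by (simp add: b_def g_def X(2))
      qed
    qed
    also have "\<dots> = m + 1 / 2" by simp
    finally have "ennreal (m + 1 / 2) \<le> ennreal m"
      using mutual_info_ge[where g=g and a=b, OF sets J d1 Y g] by (simp add: m)
    then show False using m(2) by (simp add: ennreal_le_iff)
  qed
  let ?z = "(\<chi> i. lh i, \<chi> i. \<gamma> i)"
  have "(\<integral>z. ln (channel a \<gamma> z) \<partial>J) = (\<Sum>i\<in>UNIV. ln (lam $ i / \<gamma> i) / 2 - \<gamma> i / (2 * \<gamma> i) + 1 / 2)"
    unfolding integrable_ln_channel(2)[where g=\<gamma> and a=a, OF sets J X Y \<gamma>pos] \<gamma>_def[symmetric] ..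
  also have "\<dots> = objective lam ?z"
    using \<gamma>pos by (simp add: objective_def sum_divide_distrib less_imp_neq[symmetric])
  finally have "ennreal (objective lam ?z) \<le> mutual_info J"
    using mutual_info_ge[where g=\<gamma> and a=a, OF sets J d1 Y \<gamma>pos] by simp
  moreover have "?z \<in> feasible lam D P"
    unfolding feasible_def
  proof (clarsimp, intro conjI allI)
    fix i
    show "0 < \<gamma> i" by (rule \<gamma>pos)
    show "\<gamma> i \<le> lam $ i" using lh0[of i] by (simp add: \<gamma>)
    show "0 \<le> lh i" by (rule lh0)
  next
    \<comment> \<open>The square root is \<open>\<bar>C i\<bar>\<close>, which is at least
      \<open>C i\<close>, so the distortion in the program is at most the actual one.\<close>
    have "(\<Sum>i\<in>UNIV. lam $ i - 2 * sqrt (lh i * (lam $ i - \<gamma> i)) + lh i) \<le> (\<Sum>i\<in>UNIV. lam $ i - 2 * C i + lh i)"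
    proof (intro sum_mono)
      fix i
      have "lh i * (lam $ i - \<gamma> i) = (C i)\<^sup>2"
        using C0[of i] by (cases "lh i = 0") (simp_all add: \<gamma>)
      then show "lam $ i - 2 * sqrt (lh i * (lam $ i - \<gamma> i)) + lh i \<le> lam $ i - 2 * C i + lh i"
        by simp
    qed
    also have "\<dots> \<le> D"
    proof -
      have "enn2ereal (ennreal (\<Sum>i\<in>UNIV. lam $ i - 2 * C i + lh i)) \<le> ereal D"
        using D unfolding nn_integral_dist_sq[OF sets X(1) Y] X(2) C_def lh_def .
      then show ?thesis by (rule enn2ereal_ennreal_leD)
    qed
    finally show "(\<Sum>i\<in>UNIV. lam $ i - 2 * sqrt (lh i * (lam $ i - \<gamma> i)) + lh i) \<le> D" .
  next
    have "ennreal (\<Sum>i\<in>UNIV. (sqrt (lam $ i) - sqrt (lh i))\<^sup>2) \<le> W2sq src (distr J borel snd)"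
    proof (rule W2sq_src_ge)
      fix i
      show "integrable (distr J borel snd) (\<lambda>y. (coord i y)\<^sup>2)"
        using Y[of i] by (subst integrable_distr_eq) auto
      show "(\<integral>y. (coord i y)\<^sup>2 \<partial>distr J borel snd) = lh i"
        unfolding lh_def by (subst integral_distr) auto
    qed
    then have "enn2ereal (ennreal (\<Sum>i\<in>UNIV. (sqrt (lam $ i) - sqrt (lh i))\<^sup>2)) \<le> ereal P"
      using P by (meson less_eq_ennreal.rep_eq order_trans)
    then show "(\<Sum>i\<in>UNIV. (sqrt (lam $ i) - sqrt (lh i))\<^sup>2) \<le> P"
      by (rule enn2ereal_ennreal_leD)
  qed
  ultimately show ?thesis by blast
qed

end

section \<open>Achievability and existence of a minimizer\<close>

context gaussian_source
begin

definition coord_scale :: "('n \<Rightarrow> real) \<Rightarrow> real^'n \<Rightarrow> real^'n" where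
  "coord_scale s x = transpose Theta *v (\<chi> i. s i * coord i x)"

lemma coord_coord_scale: "coord i (coord_scale s x) = s i * coord i x"
  unfolding coord_scale_def coord_def[of i "transpose Theta *v _"]
  by (simp add: matrix_vector_mul_assoc Theta_inverse del: transpose_matrix_vector)

lemma borel_measurable_coord_scale [measurable]: "coord_scale s \<in> borel_measurable borel"
proof -
  have "(\<lambda>x. \<chi> i. s i * coord i x) \<in> borel_measurable borel"
    unfolding coord_def[abs_def]
    by (intro borel_measurable_continuous_onI continuous_on_vec_lambda continuous_intros
        continuous_on_component matrix_vector_mult_linear_continuous_on)
  then show ?thesis
    unfolding coord_scale_def[abs_def] by measurable
qed

lemma nn_integral_src_coord_scale:
  "(\<integral>\<^sup>+x. ennreal ((coord i (coord_scale s x))\<^sup>2) \<partial>src) = ennreal ((s i)\<^sup>2 * lam $ i)"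
  using lam_pos[of i]
  by (simp add: coord_coord_scale power_mult_distrib ennreal_mult nn_integral_cmult nn_integral_src_square)

text \<open>The source is coupled with its own image under the scaling. For
  \<open>s i = sqrt (lh i / lam $ i)\<close> the cost equals the lower bound of
  \<open>W2sq_src_ge\<close>.\<close>

lemma W2sq_coord_scale_le:
  "W2sq src (distr src borel (coord_scale s)) \<le> ennreal (\<Sum>i\<in>UNIV. (1 - s i)\<^sup>2 * lam $ i)"
proof -
  interpret S: prob_space src by (rule prob_space_src)
  let ?\<pi> = "distr src (borel \<Otimes>\<^sub>M borel) (\<lambda>x. (x, coord_scale s x))"
  have "distr ?\<pi> borel fst = distr src borel (\<lambda>x. x)"
    by (subst distr_distr) (auto simp: o_def)
  also have "\<dots> = src" by (rule distr_id2) (simp add: sets_src)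
  finally have 1: "distr ?\<pi> borel fst = src" .
  have 2: "distr ?\<pi> borel snd = distr src borel (coord_scale s)"
    by (subst distr_distr) (auto simp: o_def)
  have "prob_space ?\<pi>" by (rule S.prob_space_distr) measurable
  then have "?\<pi> \<in> couplings src (distr src borel (coord_scale s))"
    using 1 2 by (simp add: couplings_def)
  then have "W2sq src (distr src borel (coord_scale s)) \<le> (\<integral>\<^sup>+z. ennreal ((norm (fst z - snd z))\<^sup>2) \<partial>?\<pi>)"
    unfolding W2sq_def by (rule INF_lower)
  also have "\<dots> = (\<integral>\<^sup>+x. ennreal ((norm (x - coord_scale s x))\<^sup>2) \<partial>src)"
    by (subst nn_integral_distr) auto
  also have "\<dots> = (\<integral>\<^sup>+x. (\<Sum>i\<in>UNIV. ennreal ((1 - s i)\<^sup>2) * ennreal ((coord i x)\<^sup>2)) \<partial>src)"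
  proof (rule nn_integral_cong)
    fix x
    have "(norm (x - coord_scale s x))\<^sup>2 = (\<Sum>i\<in>UNIV. (1 - s i)\<^sup>2 * (coord i x)\<^sup>2)"
      unfolding norm_sq_coord coord_diff coord_coord_scale
      by (intro sum.cong refl) (simp add: power2_eq_square algebra_simps)
    then show "ennreal ((norm (x - coord_scale s x))\<^sup>2) = (\<Sum>i\<in>UNIV. ennreal ((1 - s i)\<^sup>2) * ennreal ((coord i x)\<^sup>2))"
      by (simp add: ennreal_mult[symmetric] sum_ennreal)
  qed
  also have "\<dots> = (\<Sum>i\<in>UNIV. ennreal ((1 - s i)\<^sup>2) * ennreal (lam $ i))"
    by (simp add: nn_integral_sum nn_integral_cmult nn_integral_src_square)
  also have "\<dots> = ennreal (\<Sum>i\<in>UNIV. (1 - s i)\<^sup>2 * lam $ i)"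
    using lam_pos by (subst sum_ennreal[symmetric]) (simp_all add: ennreal_mult less_imp_le)
  finally show ?thesis .
qed

text \<open>Both partial integrals of the ratio equal one, so it defines a law with the required
  marginals and is itself the density that enters \<open>mutual_info\<close>. The residual of this
  law is \<open>g\<close>, hence the expected log-ratio is the rate.\<close>

lemma ex_joint_law_of_channel:
  assumes g: "\<And>i. 0 < g i" and r: "\<And>i. (a i * s i)\<^sup>2 * lam $ i + g i = lam $ i"
  shows "\<exists>J. prob_space J \<and> sets J = sets (borel \<Otimes>\<^sub>M borel) \<and> distr J borel fst = src
    \<and> distr J borel snd = distr src borel (coord_scale s)
    \<and> (\<integral>\<^sup>+z. ennreal ((norm (fst z - snd z))\<^sup>2) \<partial>J) = ennreal (\<Sum>i\<in>UNIV. g i + (a i - 1)\<^sup>2 * ((s i)\<^sup>2 * lam $ i))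
    \<and> mutual_info J = ennreal (\<Sum>i\<in>UNIV. ln (lam $ i / g i) / 2)"
proof -
  interpret S: prob_space src by (rule prob_space_src)
  define \<nu> where "\<nu> = distr src borel (coord_scale s)"
  have [measurable_cong]: "sets \<nu> = sets borel" by (simp add: \<nu>_def)
  interpret N: prob_space \<nu> unfolding \<nu>_def by (rule S.prob_space_distr) measurable
  interpret Q: pair_prob_space src \<nu> ..
  define Q where "Q = src \<Otimes>\<^sub>M \<nu>"
  interpret QQ: prob_space Q unfolding Q_def by (rule Q.P.prob_space_axioms)
  have sQ[measurable_cong]: "sets Q = sets (borel \<Otimes>\<^sub>M borel)"
    unfolding Q_def by (intro sets_pair_measure_cong) (simp_all add: sets_src \<nu>_def)
  let ?c = "channel a g"
  have c0: "0 < ?c z" for z by (rule channel_pos[of g, OF g])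
  have cm[measurable]: "?c \<in> borel_measurable Q" by measurable
  define J where "J = density Q (\<lambda>z. ennreal (?c z))"
  have sJ[measurable_cong]: "sets J = sets (borel \<Otimes>\<^sub>M borel)" by (simp add: J_def sQ)
  have int_x: "(\<integral>\<^sup>+x. ennreal (?c (x, y)) \<partial>src) = 1" for y
    by (rule nn_integral_channel_fst[of g, OF g])
  have int_y: "(\<integral>\<^sup>+y. ennreal (?c (x, y)) \<partial>\<nu>) = 1" for x
  proof -
    have "(\<integral>\<^sup>+y. ennreal (?c (x, y)) \<partial>\<nu>) = (\<integral>\<^sup>+x'. ennreal (?c (x, coord_scale s x')) \<partial>src)"
      unfolding \<nu>_def by (subst nn_integral_distr) auto
    then show ?thesis
      using nn_integral_channel_snd[of g "coord_scale s" s a, OF g coord_coord_scale r] by simp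
  qed
  have J_fst: "(\<integral>\<^sup>+z. h (fst z) \<partial>J) = (\<integral>\<^sup>+x. h x \<partial>src)" if [measurable]: "h \<in> borel_measurable borel" for h
  proof -
    have "(\<integral>\<^sup>+z. h (fst z) \<partial>J) = (\<integral>\<^sup>+z. ennreal (?c z) * h (fst z) \<partial>Q)"
      unfolding J_def by (subst nn_integral_density) auto
    also have "\<dots> = (\<integral>\<^sup>+x. \<integral>\<^sup>+y. ennreal (?c (x, y)) * h x \<partial>\<nu> \<partial>src)"
      unfolding Q_def by (subst N.nn_integral_fst[symmetric]) auto
    also have "\<dots> = (\<integral>\<^sup>+x. h x \<partial>src)"
      by (simp add: nn_integral_multc int_y)
    finally show ?thesis .
  qed
  have J_snd: "(\<integral>\<^sup>+z. h (snd z) \<partial>J) = (\<integral>\<^sup>+x. h x \<partial>\<nu>)" if [measurable]: "h \<in> borel_measurable borel" for h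
  proof -
    have "(\<integral>\<^sup>+z. h (snd z) \<partial>J) = (\<integral>\<^sup>+z. ennreal (?c z) * h (snd z) \<partial>Q)"
      unfolding J_def by (subst nn_integral_density) auto
    also have "\<dots> = (\<integral>\<^sup>+y. \<integral>\<^sup>+x. ennreal (?c (x, y)) * h y \<partial>src \<partial>\<nu>)"
      unfolding Q_def by (subst Q.nn_integral_snd[symmetric]) auto
    also have "\<dots> = (\<integral>\<^sup>+x. h x \<partial>\<nu>)"
      by (simp add: nn_integral_multc int_x)
    finally show ?thesis .
  qed
  have d1: "distr J borel fst = src"
  proof (rule measure_eqI)
    fix A assume "A \<in> sets (distr J borel fst)"
    then have [measurable]: "A \<in> sets borel" by simp
    have "emeasure (distr J borel fst) A = (\<integral>\<^sup>+x. indicator A x \<partial>distr J borel fst)" by simp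
    also have "\<dots> = (\<integral>\<^sup>+z. indicator A (fst z) \<partial>J)" by (subst nn_integral_distr) auto
    also have "\<dots> = emeasure src A" by (subst J_fst) (simp_all add: sets_src)
    finally show "emeasure (distr J borel fst) A = emeasure src A" .
  qed (simp add: sets_src)
  have d2: "distr J borel snd = \<nu>"
  proof (rule measure_eqI)
    fix A assume "A \<in> sets (distr J borel snd)"
    then have [measurable]: "A \<in> sets borel" by simp
    have "emeasure (distr J borel snd) A = (\<integral>\<^sup>+x. indicator A x \<partial>distr J borel snd)" by simp
    also have "\<dots> = (\<integral>\<^sup>+z. indicator A (snd z) \<partial>J)" by (subst nn_integral_distr) auto
    also have "\<dots> = emeasure \<nu> A" by (subst J_snd) (simp_all add: \<nu>_def)
    finally show "emeasure (distr J borel snd) A = emeasure \<nu> A" .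
  qed (simp add: \<nu>_def)
  have pJ: "prob_space J"
    using J_fst[of "\<lambda>_. 1"] S.emeasure_space_1 by (intro prob_spaceI) simp
  have lh: "(\<integral>\<^sup>+y. ennreal ((coord i y)\<^sup>2) \<partial>\<nu>) = ennreal ((s i)\<^sup>2 * lam $ i)" for i
    unfolding \<nu>_def by (subst nn_integral_distr) (auto simp: nn_integral_src_coord_scale)
  have X: "integrable J (\<lambda>z. (coord i (fst z))\<^sup>2)" "(\<integral>z. (coord i (fst z))\<^sup>2 \<partial>J) = lam $ i" for i
    by (intro marginal_square_moment d1; measurable)+
  have Y: "integrable J (\<lambda>z. (coord i (snd z))\<^sup>2)" for i
    using J_snd[of "\<lambda>y. ennreal ((coord i y)\<^sup>2)"] by (intro integrableI_nonneg) (auto simp: lh)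
  \<comment> \<open>The free factor \<open>b\<close> serves twice: \<open>b = 1\<close> gives the
    distortion, \<open>b = a i\<close> the residual.\<close>
  have res: "(\<integral>\<^sup>+z. ennreal ((coord i (fst z) - b * coord i (snd z))\<^sup>2) \<partial>J)
      = ennreal (g i + (a i - b)\<^sup>2 * ((s i)\<^sup>2 * lam $ i))" for i b
  proof -
    have "(\<integral>\<^sup>+z. ennreal ((coord i (fst z) - b * coord i (snd z))\<^sup>2) \<partial>J)
       = (\<integral>\<^sup>+z. ennreal (?c z * (coord i (fst z) - b * coord i (snd z))\<^sup>2) \<partial>Q)"
      unfolding J_def by (subst nn_integral_density) (auto simp: ennreal_mult c0 less_imp_le)
    also have "\<dots> = (\<integral>\<^sup>+y. \<integral>\<^sup>+x. ennreal (?c (x, y) * (coord i x - b * coord i y)\<^sup>2) \<partial>src \<partial>\<nu>)"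
      unfolding Q_def by (subst Q.nn_integral_snd[symmetric]) auto
    also have "\<dots> = (\<integral>\<^sup>+y. ennreal (g i) + ennreal ((a i - b)\<^sup>2) * ennreal ((coord i y)\<^sup>2) \<partial>\<nu>)"
    proof (rule nn_integral_cong)
      fix y
      have "(a i * coord i y - b * coord i y)\<^sup>2 = (a i - b)\<^sup>2 * (coord i y)\<^sup>2"
        by (simp add: power2_eq_square algebra_simps)
      then show "(\<integral>\<^sup>+x. ennreal (?c (x, y) * (coord i x - b * coord i y)\<^sup>2) \<partial>src)
        = ennreal (g i) + ennreal ((a i - b)\<^sup>2) * ennreal ((coord i y)\<^sup>2)"
        using g[of i] by (simp add: nn_integral_channel_square[of g, OF g] ennreal_mult[symmetric] ennreal_plus[symmetric] less_imp_le del: ennreal_plus)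
    qed
    also have "\<dots> = ennreal (g i) + ennreal ((a i - b)\<^sup>2) * ennreal ((s i)\<^sup>2 * lam $ i)"
      by (simp add: nn_integral_add nn_integral_cmult lh N.emeasure_space_1)
    also have "\<dots> = ennreal (g i + (a i - b)\<^sup>2 * ((s i)\<^sup>2 * lam $ i))"
      using g[of i] lam_pos[of i]
      by (simp add: ennreal_mult[symmetric] ennreal_plus[symmetric] less_imp_le del: ennreal_plus)
    finally show ?thesis .
  qed
  have dist: "(\<integral>\<^sup>+z. ennreal ((norm (fst z - snd z))\<^sup>2) \<partial>J)
      = ennreal (\<Sum>i\<in>UNIV. g i + (a i - 1)\<^sup>2 * ((s i)\<^sup>2 * lam $ i))"
  proof -
    have "(\<integral>\<^sup>+z. ennreal ((norm (fst z - snd z))\<^sup>2) \<partial>J)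
        = (\<integral>\<^sup>+z. (\<Sum>i\<in>UNIV. ennreal ((coord i (fst z) - 1 * coord i (snd z))\<^sup>2)) \<partial>J)"
      unfolding norm_sq_coord coord_diff by (simp add: sum_ennreal)
    also have "\<dots> = (\<Sum>i\<in>UNIV. ennreal (g i + (a i - 1)\<^sup>2 * ((s i)\<^sup>2 * lam $ i)))"
      by (subst nn_integral_sum) (simp_all only: res, measurable)
    also have "\<dots> = ennreal (\<Sum>i\<in>UNIV. g i + (a i - 1)\<^sup>2 * ((s i)\<^sup>2 * lam $ i))"
      using g lam_pos by (intro sum_ennreal) (simp add: less_imp_le)
    finally show ?thesis .
  qed
  have R: "(\<integral>z. (coord i (fst z) - a i * coord i (snd z))\<^sup>2 \<partial>J) = g i" for i
    using res[of i "a i"] g[of i] by (subst (asm) nn_integral_eq_integrable) auto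
  have iln: "integrable J (\<lambda>z. ln (?c z))"
    by (rule integrable_ln_channel[where g=g, OF sJ pJ X Y g])
  have "(\<integral>z. ln (?c z) \<partial>J) = (\<Sum>i\<in>UNIV. ln (lam $ i / g i) / 2 - g i / (2 * g i) + 1 / 2)"
    unfolding integrable_ln_channel(2)[where g=g and a=a, OF sJ pJ X Y g] R ..
  also have "\<dots> = (\<Sum>i\<in>UNIV. ln (lam $ i / g i) / 2)"
    using g by (simp add: less_imp_neq[symmetric])
  finally have Eln: "(\<integral>z. ln (?c z) \<partial>J) = (\<Sum>i\<in>UNIV. ln (lam $ i / g i) / 2)" .
  have i1: "integrable Q (\<lambda>z. ?c z * ln (?c z))"
    using iln unfolding J_def by (subst (asm) integrable_density) (auto simp: c0 less_imp_le)
  have i1': "(\<integral>z. ?c z * ln (?c z) \<partial>Q) = (\<integral>z. ln (?c z) \<partial>J)"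
    unfolding J_def by (subst integral_density) (auto simp: c0 less_imp_le)
  have "(\<integral>\<^sup>+z. ennreal (?c z) \<partial>Q) = ennreal 1"
    unfolding Q_def by (subst Q.nn_integral_snd[symmetric]) (auto simp: int_x N.emeasure_space_1)
  then have i2: "integrable Q ?c" "(\<integral>z. ?c z \<partial>Q) = 1"
    using c0 by (subst (asm) nn_integral_eq_integrable; auto simp: less_imp_le)+
  have "AE z in Q. ennreal (?c z) = RN_deriv Q J z"
    by (rule QQ.RN_deriv_unique) (auto simp: J_def)
  then have rn: "AE z in Q. enn2real (RN_deriv Q J z) = ?c z"
  proof eventually_elim
    case (elim z)
    show ?case unfolding elim[symmetric] using c0[of z] by simp
  qed
  have ac: "absolutely_continuous Q J"
    unfolding J_def by (rule absolutely_continuousI_density) simp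
  have "mutual_info J = (\<integral>\<^sup>+z. ennreal (enn2real (RN_deriv Q J z) * ln (enn2real (RN_deriv Q J z))
      - enn2real (RN_deriv Q J z) + 1) \<partial>Q)"
    unfolding mutual_info_def Let_def d1 d2 Q_def[symmetric] using ac by simp
  also have "\<dots> = (\<integral>\<^sup>+z. ennreal (?c z * ln (?c z) - ?c z + 1) \<partial>Q)"
    by (rule nn_integral_cong_AE) (use rn in eventually_elim, simp)
  also have "\<dots> = ennreal (\<integral>z. ?c z * ln (?c z) - ?c z + 1 \<partial>Q)"
  proof (rule nn_integral_eq_integral)
    have "0 \<le> ?c z * ln (?c z) - ?c z + 1" for z
      using fenchel_entropy[of "?c z" 1] c0[of z] by simp
    then show "AE z in Q. 0 \<le> ?c z * ln (?c z) - ?c z + 1" by simp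
  qed (use i1 i2 in simp)
  also have "\<dots> = ennreal (\<Sum>i\<in>UNIV. ln (lam $ i / g i) / 2)"
    using i1 i2 by (simp add: i1' Eln QQ.prob_space)
  finally have "mutual_info J = ennreal (\<Sum>i\<in>UNIV. ln (lam $ i / g i) / 2)" .
  with pJ sJ d1 d2 dist show ?thesis
    unfolding \<nu>_def by blast
qed

lemma RDP_le_objective:
  assumes z: "z \<in> feasible lam D P"
  shows "RDP src D P \<le> ennreal (objective lam z)"
proof -
  obtain lh g0 where zeq: "z = (lh, g0)" by (cases z)
  have g0: "0 < g0 $ i" "g0 $ i \<le> lam $ i" and lh0: "0 \<le> lh $ i" for i
    using z by (auto simp: zeq feasible_def)
  have D0: "(\<Sum>i\<in>UNIV. lam $ i - 2 * sqrt (lh $ i * (lam $ i - g0 $ i)) + lh $ i) \<le> D"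
    and P0: "(\<Sum>i\<in>UNIV. (sqrt (lam $ i) - sqrt (lh $ i))\<^sup>2) \<le> P"
    using z by (auto simp: zeq feasible_def)
  \<comment> \<open>A component with zero reconstruction power carries no information, so it costs nothing to set \<open>\<gamma> = \<lambda>\<close>
    there; otherwise the backward channel would not have the right first marginal.\<close>
  define g where "g i = (if lh $ i = 0 then lam $ i else g0 $ i)" for i
  \<comment> \<open>\<open>s\<close> gives reconstruction coordinate \<open>i\<close> the variance
    \<open>lh $ i\<close>, and \<open>a\<close> is the nonnegative gain solving the variance balance
    \<open>r\<close>. Where \<open>lh $ i = 0\<close>, both are 0, in agreement with
    \<open>g i = lam $ i\<close>.\<close>
  define s where "s i = sqrt (lh $ i / lam $ i)" for i
  define a where "a i = sqrt ((lam $ i - g i) / lam $ i) / s i" for i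
  have g: "0 < g i" "g i \<le> lam $ i" "g0 $ i \<le> g i" for i using g0 lam_pos by (auto simp: g_def)
  have s2: "(s i)\<^sup>2 * lam $ i = lh $ i" for i
    using lam_pos[of i] lh0[of i] by (simp add: s_def)
  have as: "a i * s i = sqrt ((lam $ i - g i) / lam $ i)" for i
    using lam_pos[of i] by (auto simp: a_def s_def g_def)
  have r: "(a i * s i)\<^sup>2 * lam $ i + g i = lam $ i" for i
    using g[of i] lam_pos[of i] by (simp add: as)
  obtain J where J: "prob_space J" "sets J = sets (borel \<Otimes>\<^sub>M borel)" "distr J borel fst = src"
    "distr J borel snd = distr src borel (coord_scale s)"
    and dist: "(\<integral>\<^sup>+z. ennreal ((norm (fst z - snd z))\<^sup>2) \<partial>J) = ennreal (\<Sum>i\<in>UNIV. g i + (a i - 1)\<^sup>2 * ((s i)\<^sup>2 * lam $ i))"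
    and MI: "mutual_info J = ennreal (\<Sum>i\<in>UNIV. ln (lam $ i / g i) / 2)"
    using ex_joint_law_of_channel[of g a s, OF g(1) r] by blast
  \<comment> \<open>Passing from \<open>g0\<close> to \<open>g\<close> leaves the distortion
    unchanged: by \<open>r\<close> the source variance is still \<open>lam $ i\<close>, and the
    cross term is zero wherever the two differ.\<close>
  have "g i + (a i - 1)\<^sup>2 * ((s i)\<^sup>2 * lam $ i) = lam $ i - 2 * sqrt (lh $ i * (lam $ i - g0 $ i)) + lh $ i" for i
  proof -
    have "a i * (s i)\<^sup>2 * lam $ i = (a i * s i) * (s i * lam $ i)" by (simp add: power2_eq_square)
    also have "\<dots> = sqrt ((lam $ i - g i) / lam $ i) * sqrt (lh $ i / lam $ i) * (sqrt (lam $ i))\<^sup>2"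
      using lam_pos[of i] unfolding as by (simp add: s_def)
    also have "\<dots> = sqrt (lh $ i * (lam $ i - g i))"
      using lam_pos[of i] by (simp add: real_sqrt_divide real_sqrt_mult power2_eq_square)
    also have "\<dots> = sqrt (lh $ i * (lam $ i - g0 $ i))" by (simp add: g_def)
    finally have cross: "a i * (s i)\<^sup>2 * lam $ i = sqrt (lh $ i * (lam $ i - g0 $ i))" .
    have "g i + (a i - 1)\<^sup>2 * ((s i)\<^sup>2 * lam $ i)
      = ((a i * s i)\<^sup>2 * lam $ i + g i) - 2 * (a i * (s i)\<^sup>2 * lam $ i) + (s i)\<^sup>2 * lam $ i"
      by (simp add: power2_eq_square algebra_simps)
    then show ?thesis unfolding r cross s2 .
  qed
  then have dist_le: "(\<Sum>i\<in>UNIV. g i + (a i - 1)\<^sup>2 * ((s i)\<^sup>2 * lam $ i)) \<le> D"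
    using D0 by simp
  have "0 \<le> (\<Sum>i\<in>UNIV. g i + (a i - 1)\<^sup>2 * ((s i)\<^sup>2 * lam $ i))"
    using g(1) lam_pos by (intro sum_nonneg) (simp add: less_imp_le)
  then have Dc: "enn2ereal (\<integral>\<^sup>+z. ennreal ((norm (fst z - snd z))\<^sup>2) \<partial>J) \<le> ereal D"
    using dist_le unfolding dist by (simp add: enn2ereal_ennreal)
  have "(1 - s i)\<^sup>2 * lam $ i = (sqrt (lam $ i) - sqrt (lh $ i))\<^sup>2" for i
  proof -
    have "(1 - s i)\<^sup>2 * lam $ i = ((1 - s i) * sqrt (lam $ i))\<^sup>2"
      using lam_pos[of i] by (simp add: power_mult_distrib)
    also have "(1 - s i) * sqrt (lam $ i) = sqrt (lam $ i) - sqrt (lh $ i)"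
      using lam_pos[of i] by (simp add: s_def real_sqrt_divide left_diff_distrib)
    finally show ?thesis .
  qed
  then have "W2sq src (distr J borel snd) \<le> ennreal (\<Sum>i\<in>UNIV. (sqrt (lam $ i) - sqrt (lh $ i))\<^sup>2)"
    using W2sq_coord_scale_le[of s] by (simp add: J)
  then have "enn2ereal (W2sq src (distr J borel snd)) \<le> enn2ereal (ennreal (\<Sum>i\<in>UNIV. (sqrt (lam $ i) - sqrt (lh $ i))\<^sup>2))"
    by (simp add: less_eq_ennreal.rep_eq)
  also have "\<dots> \<le> ereal P"
    using P0 by (simp add: enn2ereal_ennreal sum_nonneg)
  finally have Pc: "enn2ereal (W2sq src (distr J borel snd)) \<le> ereal P" .
  have "RDP src D P \<le> mutual_info J"
    unfolding RDP_def using J(1-3) Dc Pc by (intro INF_lower) simp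
  also have "\<dots> \<le> ennreal (objective lam z)"
    unfolding MI
  proof (rule ennreal_leI)
    have "(\<Sum>i\<in>UNIV. ln (lam $ i / g i) / 2) \<le> (\<Sum>i\<in>UNIV. ln (lam $ i / g0 $ i) / 2)"
      using g g0 lam_pos
      by (intro sum_mono divide_right_mono) (auto intro!: divide_left_mono mult_pos_pos simp: less_imp_le)
    then show "(\<Sum>i\<in>UNIV. ln (lam $ i / g i) / 2) \<le> objective lam z"
      by (simp add: objective_def zeq sum_divide_distrib)
  qed
  finally show ?thesis .
qed

text \<open>The feasible set need not be closed because of the strict bound on
  \<open>\<gamma>\<close>. Every log term is nonnegative, so at objective at most \<open>c\<close>
  each is at most \<open>2 * c\<close>, which keeps \<open>\<gamma>\<close> above
  \<open>lam $ i * exp (- (2 * c))\<close>. The minimum is then sought on the compact set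
  \<open>K\<close>, which contains all such points.\<close>

lemma objective_attains_min:
  assumes "feasible lam D P \<noteq> {}"
  shows "\<exists>z\<in>feasible lam D P. \<forall>w\<in>feasible lam D P. objective lam z \<le> objective lam w"
proof -
  obtain w0 where w0: "w0 \<in> feasible lam D P" using assms by blast
  define c where "c = objective lam w0"
  define K where "K = {z \<in> feasible lam D P. \<forall>i. lam $ i * exp (- (2 * c)) \<le> snd z $ i}"
  have sub: "w \<in> K" if w: "w \<in> feasible lam D P" "objective lam w \<le> c" for w
  proof -
    have pos: "0 < snd w $ i" "snd w $ i \<le> lam $ i" for i
      using w(1) by (auto simp: feasible_def)
    have "lam $ i * exp (- (2 * c)) \<le> snd w $ i" for i
    proof -
      have "ln (lam $ i / snd w $ i) \<le> (\<Sum>i\<in>UNIV. ln (lam $ i / snd w $ i))"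
        using pos lam_pos by (intro member_le_sum) auto
      also have "\<dots> \<le> 2 * c" using w(2) by (simp add: objective_def)
      finally have "lam $ i / snd w $ i \<le> exp (2 * c)"
        using pos[of i] lam_pos[of i] exp_le_cancel_iff[of "ln (lam $ i / snd w $ i)" "2 * c"] by simp
      then show ?thesis
        using pos[of i] by (simp add: exp_minus field_simps)
    qed
    then show ?thesis using w by (simp add: K_def)
  qed
  have Kpos: "0 < b $ i" if "\<forall>i. lam $ i * exp (- (2 * c)) \<le> b $ i" for i and b :: "real^'n"
    using that lam_pos[of i] by (smt (verit) exp_gt_zero mult_pos_pos)
  have Keq: "K = {z. (\<forall>i. lam $ i * exp (- (2 * c)) \<le> snd z $ i) \<and> (\<forall>i. snd z $ i \<le> lam $ i) \<and> (\<forall>i. 0 \<le> fst z $ i)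
     \<and> (\<Sum>i\<in>UNIV. lam $ i - 2 * sqrt (fst z $ i * (lam $ i - snd z $ i)) + fst z $ i) \<le> D
     \<and> (\<Sum>i\<in>UNIV. (sqrt (lam $ i) - sqrt (fst z $ i))\<^sup>2) \<le> P}"
    unfolding K_def feasible_def by (auto intro: Kpos)
  have "closed K"
    unfolding Keq by (intro closed_Collect_conj closed_Collect_all closed_Collect_le continuous_intros)
  moreover have "bounded K"
  proof (rule bounded_subset)
    \<comment> \<open>The perception constraint confines \<open>sqrt (fst z $ i)\<close> to within
      \<open>sqrt P\<close> of \<open>sqrt (lam $ i)\<close>.\<close>
    show "bounded (cbox 0 (\<chi> i. (sqrt (lam $ i) + sqrt P)\<^sup>2) \<times> cbox 0 lam)"
      by (intro bounded_Times bounded_cbox)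
    show "K \<subseteq> cbox 0 (\<chi> i. (sqrt (lam $ i) + sqrt P)\<^sup>2) \<times> cbox 0 lam"
    proof
      fix z assume z: "z \<in> K"
      have "fst z $ i \<le> (sqrt (lam $ i) + sqrt P)\<^sup>2" for i
      proof -
        have "(sqrt (lam $ i) - sqrt (fst z $ i))\<^sup>2 \<le> (\<Sum>i\<in>UNIV. (sqrt (lam $ i) - sqrt (fst z $ i))\<^sup>2)"
          by (rule member_le_sum) auto
        also have "\<dots> \<le> P" using z by (simp add: Keq)
        finally have "\<bar>sqrt (lam $ i) - sqrt (fst z $ i)\<bar> \<le> sqrt P"
          by (simp add: real_le_rsqrt)
        then have "sqrt (fst z $ i) \<le> sqrt (lam $ i) + sqrt P" by linarith
        moreover have "0 \<le> fst z $ i" using z by (simp add: Keq)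
        ultimately show ?thesis
          by (metis power_mono real_sqrt_ge_zero real_sqrt_pow2)
      qed
      moreover have "0 \<le> fst z $ i" "0 \<le> snd z $ i" "snd z $ i \<le> lam $ i" for i
        using z by (auto simp: Keq intro: Kpos less_imp_le)
      ultimately show "z \<in> cbox 0 (\<chi> i. (sqrt (lam $ i) + sqrt P)\<^sup>2) \<times> cbox 0 lam"
        by (cases z) (simp add: mem_box_cart)
    qed
  qed
  ultimately have "compact K" by (simp add: compact_eq_bounded_closed)
  moreover have "K \<noteq> {}" using sub[OF w0] by (auto simp: c_def)
  moreover have "continuous_on K (objective lam)"
    unfolding objective_def[abs_def]
  proof (intro continuous_intros ballI)
    fix z i assume z: "z \<in> K"
    have "0 < snd z $ i" using z by (auto simp: Keq intro: Kpos)
    then show "snd z $ i \<noteq> 0" "lam $ i / snd z $ i \<noteq> 0" using lam_pos[of i] by auto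
  qed
  ultimately obtain z where z: "z \<in> K" "\<And>w. w \<in> K \<Longrightarrow> objective lam z \<le> objective lam w"
    using continuous_attains_inf[of K "objective lam"] by blast
  show ?thesis
  proof (intro bexI ballI)
    show "z \<in> feasible lam D P" using z by (simp add: K_def)
    fix w assume w: "w \<in> feasible lam D P"
    show "objective lam z \<le> objective lam w"
    proof (cases "objective lam w \<le> c")
      case True
      then show ?thesis using sub[OF w] z by blast
    next
      case False
      moreover have "objective lam z \<le> c" using sub[OF w0] z by (simp add: c_def)
      ultimately show ?thesis by linarith
    qed
  qed
qed

end

section \<open>Equality of the two infima and attainment\<close>

theorem theorem5:
  fixes Theta :: "real^'n^'n" and lam :: "real^'n" and D P :: real
  assumes "orthogonal_matrix Theta"
    and "\<forall>i. 0 < lam $ i"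
  shows "RDP (gaussian_measure (transpose Theta ** diag_mat lam ** Theta)) D P
           = (INF z \<in> feasible lam D P. ennreal (objective lam z))
       \<and> (feasible lam D P \<noteq> {} \<longrightarrow>
           (\<exists>z\<in>feasible lam D P. \<forall>w\<in>feasible lam D P. objective lam z \<le> objective lam w))"
proof -
  interpret gaussian_source Theta lam
    using assms by unfold_locales auto
  have "RDP src D P = (INF z \<in> feasible lam D P. ennreal (objective lam z))"
  proof (rule antisym)
    show "RDP src D P \<le> (INF z \<in> feasible lam D P. ennreal (objective lam z))"
      by (intro INF_greatest RDP_le_objective)
    show "(INF z \<in> feasible lam D P. ennreal (objective lam z)) \<le> RDP src D P"
      unfolding RDP_def
    proof (rule INF_greatest, clarsimp)
      fix J assume J: "prob_space J" "sets J = sets (borel \<Otimes>\<^sub>M borel)" "distr J borel fst = src"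
        "enn2ereal (\<integral>\<^sup>+ z. ennreal ((norm (fst z - snd z))\<^sup>2) \<partial>J) \<le> ereal D"
        "enn2ereal (W2sq src (distr J borel snd)) \<le> ereal P"
      \<comment> \<open>Joint laws of infinite mutual information satisfy the bound trivially; only
        the others have to supply a feasible point.\<close>
      show "(INF z \<in> feasible lam D P. ennreal (objective lam z)) \<le> mutual_info J"
      proof (cases "mutual_info J = \<top>")
        case False
        then obtain z where "z \<in> feasible lam D P" "ennreal (objective lam z) \<le> mutual_info J"
          using ex_feasible_objective_le_mutual_info[OF J(2,1,3,4,5)] by blast
        then show ?thesis by (rule INF_lower2)
      qed simp
    qed
  qed
  then show ?thesis
    using objective_attains_min unfolding src_def by blast
qed

end
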